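(* Let $s$ be a primitive string over $\Sigma$ with $|\Sigma|=\sigma$, and suppose $BWT_*(s)$ is a context adaptive BWT based on a local ordering and supports constant time rank queries. After an $\mathcal{O}(\sigma^2)$ time preprocessing, given any string $x=x_1x_2\cdots x_p$, the range of rows of $M_*(s)$ prefixed by $x$ can be computed in $\mathcal{O}(p)$ time and $\mathcal{O}(p)$ space.
   Context: A string is primitive if all its cyclic rotations are distinct. A context adaptive BWT: for every string $x$ an ordering (permutation) $\pi_x$ of $\Sigma$ is fixed; the matrix $M_*(s)$ has as rows all cyclic rotations of $s$, sorted so that, for two distinct rotations whose longest common prefix is $x$, the one whose $(|x|+1)$-st symbol is smaller according to $\pi_x$ comes first; $BWT_*(s)$ is the last column of $M_*(s)$. It is based on a local ordering if $\pi_x$ depends only on the last symbol of $x$ for every nonempty $x$ (orderings $\pi_\epsilon$ and $\pi_c$, $c\in\Sigma$); these orderings are known. The rows prefixed by a string form a contiguous range of $M_*(s)$. Constant time rank: $\mathrm{rank}_c(BWT_*(s),i)$, the number of occurrences of $c$ in the first $i$ symbols, in $\mathcal{O}(1)$ time. Computation model: word RAM with word size $w$, $\sigma=w^{\mathcal{O}(1)}$. *)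

theory Defs
  imports Main "HOL-Library.Sublist" "HOL-Library.Multiset"
begin

section \<open>Context adaptive Burrows-Wheeler transforms\<close>

definition rotations :: "'a list \<Rightarrow> 'a list list" where
  "rotations s = map (\<lambda>i. rotate i s) [0..<length s]"

definition primitive :: "'a list \<Rightarrow> bool" where
  "primitive s \<longleftrightarrow> distinct (rotations s)"

text \<open>An ordering of a finite alphabet is the list of its symbols, smallest first.\<close>

definition precedes :: "'a list \<Rightarrow> 'a \<Rightarrow> 'a \<Rightarrow> bool" where
  "precedes ord a b \<longleftrightarrow> (\<exists>i j. i < j \<and> j < length ord \<and> ord ! i = a \<and> ord ! j = b)"

definition context_orderings :: "'a set \<Rightarrow> ('a list \<Rightarrow> 'a list) \<Rightarrow> bool" where
  "context_orderings \<Sigma> \<pi> \<longleftrightarrow> (\<forall>x \<in> lists \<Sigma>. distinct (\<pi> x) \<and> set (\<pi> x) = \<Sigma>)"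

definition local_ordering :: "'a set \<Rightarrow> ('a list \<Rightarrow> 'a list) \<Rightarrow> bool" where
  "local_ordering \<Sigma> \<pi> \<longleftrightarrow>
     (\<forall>x \<in> lists \<Sigma>. \<forall>y \<in> lists \<Sigma>. x \<noteq> [] \<longrightarrow> y \<noteq> [] \<longrightarrow> last x = last y \<longrightarrow> \<pi> x = \<pi> y)"

text \<open>Only meaningful for two distinct strings of the same length.\<close>

definition ctx_less :: "('a list \<Rightarrow> 'a list) \<Rightarrow> 'a list \<Rightarrow> 'a list \<Rightarrow> bool" where
  "ctx_less \<pi> u v \<longleftrightarrow>
     (let x = longest_common_prefix u v
      in precedes (\<pi> x) (u ! length x) (v ! length x))"

definition is_ctx_matrix :: "('a list \<Rightarrow> 'a list) \<Rightarrow> 'a list \<Rightarrow> 'a list list \<Rightarrow> bool" where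
  "is_ctx_matrix \<pi> s M \<longleftrightarrow>
     mset M = mset (rotations s) \<and> sorted_wrt (\<lambda>u v. u \<noteq> v \<longrightarrow> ctx_less \<pi> u v) M"

text \<open>The description operator below is justified by lemma \<open>ex1_ctx_matrix\<close>.\<close>

definition ctx_matrix :: "('a list \<Rightarrow> 'a list) \<Rightarrow> 'a list \<Rightarrow> 'a list list" where
  "ctx_matrix \<pi> s = (THE M. is_ctx_matrix \<pi> s M)"

definition ctx_bwt :: "('a list \<Rightarrow> 'a list) \<Rightarrow> 'a list \<Rightarrow> 'a list" where
  "ctx_bwt \<pi> s = map last (ctx_matrix \<pi> s)"

definition rank :: "'a \<Rightarrow> 'a list \<Rightarrow> nat \<Rightarrow> nat" where
  "rank c L i = count_list (take i L) c"

text \<open>Rows are numbered from 0 and the range is \<open>[b, e)\<close>; it is empty iff \<open>b = e\<close>.\<close>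

definition is_row_range ::
  "('a list \<Rightarrow> 'a list) \<Rightarrow> 'a list \<Rightarrow> 'a list \<Rightarrow> nat \<Rightarrow> nat \<Rightarrow> bool" where
  "is_row_range \<pi> s x b e \<longleftrightarrow>
     b \<le> e \<and> e \<le> length s \<and>
     {i. i < length s \<and> prefix x (ctx_matrix \<pi> s ! i)} = {b..<e}"


subsection \<open>Existence and uniqueness of the matrix\<close>

lemma ctx_less_Cons:
  "ctx_less \<pi> (a # u) (b # v) \<longleftrightarrow>
     (if a = b then ctx_less (\<lambda>x. \<pi> (a # x)) u v else precedes (\<pi> []) a b)"
  by (simp add: ctx_less_def Let_def)

lemma context_orderings_Cons:
  "context_orderings \<Sigma> \<pi> \<Longrightarrow> a \<in> \<Sigma> \<Longrightarrow> context_orderings \<Sigma> (\<lambda>x. \<pi> (a # x))"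
  by (auto simp: context_orderings_def)

lemma precedes_total:
  assumes "a \<in> set ord" "b \<in> set ord" "a \<noteq> b"
  shows "precedes ord a b \<or> precedes ord b a"
proof -
  obtain i j where "i < length ord" "ord ! i = a" "j < length ord" "ord ! j = b"
    using assms(1,2) unfolding in_set_conv_nth by blast
  moreover from this have "i < j \<or> j < i" using assms(3) by (metis linorder_neqE_nat)
  ultimately show ?thesis unfolding precedes_def by blast
qed

lemma precedes_trans:
  assumes "distinct ord" "precedes ord a b" "precedes ord b c"
  shows "precedes ord a c"
proof -
  obtain i j j' k where *: "i < j" "j < length ord" "ord ! i = a" "ord ! j = b"
    "j' < k" "k < length ord" "ord ! j' = b" "ord ! k = c"
    using assms(2,3) unfolding precedes_def by blast
  then have "j = j'" using nth_eq_iff_index_eq[OF assms(1), of j j'] by simp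
  then have "i < k" using * by simp
  then show ?thesis unfolding precedes_def using * by blast
qed

lemma precedes_irrefl: "distinct ord \<Longrightarrow> \<not> precedes ord a a"
  unfolding precedes_def by (auto simp: nth_eq_iff_index_eq)

lemma ctx_less_total:
  assumes "context_orderings \<Sigma> \<pi>" "length u = length v" "set u \<subseteq> \<Sigma>" "set v \<subseteq> \<Sigma>" "u \<noteq> v"
  shows "ctx_less \<pi> u v \<or> ctx_less \<pi> v u"
  using assms(2,1,3-)
proof (induction u v arbitrary: \<pi> rule: list_induct2)
  case (Cons a u b v)
  show ?case
  proof (cases "a = b")
    case True
    then show ?thesis using Cons by (simp add: ctx_less_Cons context_orderings_Cons)
  next
    case False
    have "set (\<pi> []) = \<Sigma>" using Cons.prems(1) by (simp add: context_orderings_def)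
    then show ?thesis using False Cons.prems precedes_total[of a "\<pi> []" b]
      by (auto simp: ctx_less_Cons)
  qed
qed simp

lemma ctx_less_asym:
  assumes "context_orderings \<Sigma> \<pi>" "length u = length v" "set u \<subseteq> \<Sigma>" "set v \<subseteq> \<Sigma>" "u \<noteq> v"
    "ctx_less \<pi> u v"
  shows "\<not> ctx_less \<pi> v u"
  using assms(2,1,3-)
proof (induction u v arbitrary: \<pi> rule: list_induct2)
  case (Cons a u b v)
  have d: "distinct (\<pi> [])" using Cons.prems(1) by (simp add: context_orderings_def)
  have IH: "a = b \<Longrightarrow> ?case"
    using Cons.IH[of "\<lambda>x. \<pi> (a # x)"] Cons.prems context_orderings_Cons[of \<Sigma> \<pi> a]
    by (simp add: ctx_less_Cons)
  show ?case
  proof (cases "a = b")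
    case False
    then have "precedes (\<pi> []) a b" using Cons.prems by (simp add: ctx_less_Cons)
    then show ?thesis
      using False precedes_trans[OF d, of b a b] precedes_irrefl[OF d] by (auto simp: ctx_less_Cons)
  qed (rule IH)
qed simp

lemma ctx_less_trans:
  assumes "context_orderings \<Sigma> \<pi>" "length u = length v" "length v = length z"
    "set u \<subseteq> \<Sigma>" "set v \<subseteq> \<Sigma>" "set z \<subseteq> \<Sigma>" "u \<noteq> v" "v \<noteq> z"
    "ctx_less \<pi> u v" "ctx_less \<pi> v z"
  shows "u \<noteq> z \<and> ctx_less \<pi> u z"
  using assms(2,3,1,4-)
proof (induction u v z arbitrary: \<pi> rule: list_induct3)
  case (Cons a u b v c z)
  have d: "distinct (\<pi> [])" using Cons.prems(1) by (simp add: context_orderings_def)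
  have co: "context_orderings \<Sigma> (\<lambda>x. \<pi> (a # x))"
    using Cons.prems by (simp add: context_orderings_Cons)
  show ?case
  proof (cases "a = b \<and> b = c")
    case True
    then show ?thesis using Cons.IH[OF co] Cons.prems by (simp add: ctx_less_Cons)
  next
    case False
    have "a \<noteq> b \<Longrightarrow> precedes (\<pi> []) a b" "b \<noteq> c \<Longrightarrow> precedes (\<pi> []) b c"
      using Cons.prems by (simp_all add: ctx_less_Cons)
    then have "precedes (\<pi> []) a c"
      using False precedes_trans[OF d, of a b c] by (cases "a = b"; cases "b = c") simp_all
    moreover from this have "a \<noteq> c" using precedes_irrefl[OF d, of a] by auto
    ultimately show ?thesis by (simp add: ctx_less_Cons)
  qed
qed simp

lemma ex_sorted_wrt_mset:
  assumes total: "\<And>u v. u \<in> A \<Longrightarrow> v \<in> A \<Longrightarrow> R u v \<or> R v u"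
    and trans: "\<And>u v z. u \<in> A \<Longrightarrow> v \<in> A \<Longrightarrow> z \<in> A \<Longrightarrow> R u v \<Longrightarrow> R v z \<Longrightarrow> R u z"
    and "set xs \<subseteq> A"
  shows "\<exists>ys. mset ys = mset xs \<and> sorted_wrt R ys"
  using \<open>set xs \<subseteq> A\<close>
proof (induction xs)
  case (Cons x xs)
  then obtain ys where ys: "mset ys = mset xs" "sorted_wrt R ys" by auto
  have A: "x \<in> A" "set ys \<subseteq> A" using Cons.prems mset_eq_setD[OF ys(1)] by auto
  have "\<exists>zs. mset zs = add_mset x (mset ys) \<and> sorted_wrt R zs"
    using A(2) ys(2)
  proof (induction ys)
    case Nil
    show ?case by (rule exI[of _ "[x]"]) simp
  next
    case (Cons y ys)
    show ?case
    proof (cases "R x y")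
      case True
      then have "sorted_wrt R (x # y # ys)" using Cons.prems trans[of x y] A(1) by auto
      then show ?thesis by (metis mset.simps(2))
    next
      case False
      then have "R y x" using total Cons.prems A(1) by auto
      moreover obtain zs where zs: "mset zs = add_mset x (mset ys)" "sorted_wrt R zs"
        using Cons by auto
      moreover have "set zs = insert x (set ys)"
        using arg_cong[OF zs(1), of set_mset] by simp
      ultimately have "sorted_wrt R (y # zs)" using Cons.prems by auto
      then show ?thesis using zs(1) by (intro exI[of _ "y # zs"]) simp
    qed
  qed
  then show ?case using ys(1) by simp
qed simp

lemma sorted_wrt_mset_unique:
  assumes "\<And>u v. u \<in> set xs \<Longrightarrow> v \<in> set xs \<Longrightarrow> R u v \<Longrightarrow> R v u \<Longrightarrow> u = v"
    and "mset xs = mset ys" "sorted_wrt R xs" "sorted_wrt R ys"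
  shows "xs = ys"
  using assms
proof (induction xs arbitrary: ys)
  case Nil
  show ?case using Nil.prems(2) by simp
next
  case (Cons x xs)
  obtain y ys' where ys: "ys = y # ys'" using Cons.prems(2) by (cases ys) auto
  have S: "set (x # xs) = set ys" by (rule mset_eq_setD[OF Cons.prems(2)])
  then have "x \<in> set (y # ys')" "y \<in> set (x # xs)" unfolding ys by auto
  then have "x = y \<or> (R x y \<and> R y x)" using Cons.prems(3,4) unfolding ys by auto
  then have "x = y" using Cons.prems(1)[of x y] \<open>y \<in> set (x # xs)\<close> by auto
  moreover have "xs = ys'"
  proof (rule Cons.IH)
    show "u = v" if "u \<in> set xs" "v \<in> set xs" "R u v" "R v u" for u v
      using Cons.prems(1)[of u v] that by simp
    show "mset xs = mset ys'" "sorted_wrt R xs" "sorted_wrt R ys'"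
      using Cons.prems(2-4) ys \<open>x = y\<close> by simp_all
  qed
  ultimately show ?case using ys by simp
qed

lemma ex1_ctx_matrix:
  assumes "context_orderings \<Sigma> \<pi>" "set s \<subseteq> \<Sigma>"
  shows "\<exists>!M. is_ctx_matrix \<pi> s M"
proof -
  define A where "A = {u. length u = length s \<and> set u \<subseteq> \<Sigma>}"
  let ?R = "\<lambda>u v. u \<noteq> v \<longrightarrow> ctx_less \<pi> u v"
  have R: "set (rotations s) \<subseteq> A" using assms(2) by (auto simp: rotations_def A_def)
  have ex: "\<exists>M. is_ctx_matrix \<pi> s M" unfolding is_ctx_matrix_def
  proof (rule ex_sorted_wrt_mset[OF _ _ R])
    show "?R u v \<or> ?R v u" if "u \<in> A" "v \<in> A" for u v
      using that ctx_less_total[OF assms(1), of u v] by (auto simp: A_def)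
    show "?R u z" if "u \<in> A" "v \<in> A" "z \<in> A" "?R u v" "?R v z" for u v z
    proof (cases "u = v \<or> v = z")
      case False
      then show ?thesis using that ctx_less_trans[OF assms(1), of u v z] by (simp add: A_def)
    qed (use that in blast)
  qed
  have "M = N" if "is_ctx_matrix \<pi> s M" "is_ctx_matrix \<pi> s N" for M N
  proof (rule sorted_wrt_mset_unique)
    show "mset M = mset N" "sorted_wrt ?R M" "sorted_wrt ?R N"
      using that by (auto simp: is_ctx_matrix_def)
    have "set M = set (rotations s)"
      by (rule mset_eq_setD) (use that(1) in \<open>simp add: is_ctx_matrix_def\<close>)
    then have M: "set M \<subseteq> A" using R by simp
    show "u = v" if uv: "u \<in> set M" "v \<in> set M" "?R u v" "?R v u" for u v
    proof (rule ccontr)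
      assume ne: "u \<noteq> v"
      have "u \<in> A" "v \<in> A" using M uv(1,2) by auto
      then have "\<not> ctx_less \<pi> v u"
        using ctx_less_asym[OF assms(1), of u v] ne uv(3) by (simp add: A_def)
      then show False using ne uv(4) by simp
    qed
  qed
  with ex show ?thesis by blast
qed


section \<open>Word RAM with rank queries\<close>

text \<open>
  Registers and memory cells hold words, i.e. naturals below \<open>2 ^ w\<close>; addresses are words too.
  Every instruction takes one time unit. Programs do not depend on \<open>w\<close>, and a program
  mentions only finitely many registers.
\<close>

datatype arith_op = Add | Sub | Mul | Div | Mod | And | Or | Xor | Shl | Shr

datatype instr =
    Const nat nat
  | Move nat nat
  | Arith arith_op nat nat nat
  | Load nat nat
  | Store nat nat
  | Rank nat nat nat
  | Jump nat
  | JumpLess nat nat nat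

type_synonym program = "instr list"

record state =
  pc :: nat
  regs :: "nat \<Rightarrow> nat"
  mem :: "nat \<Rightarrow> nat"

fun arith :: "nat \<Rightarrow> arith_op \<Rightarrow> nat \<Rightarrow> nat \<Rightarrow> nat" where
  "arith w Add a b = (a + b) mod 2 ^ w"
| "arith w Sub a b = (a + 2 ^ w - b) mod 2 ^ w"
| "arith w Mul a b = (a * b) mod 2 ^ w"
| "arith w Div a b = a div b"
| "arith w Mod a b = a mod b"
| "arith w And a b = Bit_Operations.and a b"
| "arith w Or a b = Bit_Operations.or a b"
| "arith w Xor a b = Bit_Operations.xor a b"
| "arith w Shl a b = push_bit b a mod 2 ^ w"
| "arith w Shr a b = drop_bit b a"

definition set_reg :: "nat \<Rightarrow> nat \<Rightarrow> state \<Rightarrow> state" where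
  "set_reg r v st = st\<lparr>pc := Suc (pc st), regs := (regs st)(r := v)\<rparr>"

text \<open>\<open>rk\<close> is the function that answers the rank queries.\<close>

fun exec :: "nat \<Rightarrow> (nat \<Rightarrow> nat \<Rightarrow> nat) \<Rightarrow> instr \<Rightarrow> state \<Rightarrow> state" where
  "exec w rk (Const r k) st = set_reg r (k mod 2 ^ w) st"
| "exec w rk (Move r a) st = set_reg r (regs st a) st"
| "exec w rk (Arith f r a b) st = set_reg r (arith w f (regs st a) (regs st b)) st"
| "exec w rk (Load r a) st = set_reg r (mem st (regs st a)) st"
| "exec w rk (Store a r) st =
     st\<lparr>pc := Suc (pc st), mem := (mem st)(regs st a := regs st r)\<rparr>"
| "exec w rk (Rank r c i) st = set_reg r (rk (regs st c) (regs st i) mod 2 ^ w) st"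
| "exec w rk (Jump l) st = st\<lparr>pc := l\<rparr>"
| "exec w rk (JumpLess a b l) st =
     st\<lparr>pc := (if regs st a < regs st b then l else Suc (pc st))\<rparr>"

definition halted :: "program \<Rightarrow> state \<Rightarrow> bool" where
  "halted P st \<longleftrightarrow> length P \<le> pc st"

definition step :: "nat \<Rightarrow> (nat \<Rightarrow> nat \<Rightarrow> nat) \<Rightarrow> program \<Rightarrow> state \<Rightarrow> state" where
  "step w rk P st = (if halted P st then st else exec w rk (P ! pc st) st)"

text \<open>Started in \<open>st\<close>, the program stops after exactly \<open>t\<close> steps in \<open>st'\<close>.\<close>

definition terminates ::
  "nat \<Rightarrow> (nat \<Rightarrow> nat \<Rightarrow> nat) \<Rightarrow> program \<Rightarrow> state \<Rightarrow> nat \<Rightarrow> state \<Rightarrow> bool" where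
  "terminates w rk P st t st' \<longleftrightarrow>
     (step w rk P ^^ t) st = st' \<and> halted P st' \<and>
     (\<forall>i<t. \<not> halted P ((step w rk P ^^ i) st))"

fun instr_reads :: "instr \<Rightarrow> state \<Rightarrow> nat set" where
  "instr_reads (Load r a) st = {regs st a}"
| "instr_reads _ st = {}"

fun instr_writes :: "instr \<Rightarrow> state \<Rightarrow> nat set" where
  "instr_writes (Store a r) st = {regs st a}"
| "instr_writes _ st = {}"

definition cells_read ::
  "nat \<Rightarrow> (nat \<Rightarrow> nat \<Rightarrow> nat) \<Rightarrow> program \<Rightarrow> state \<Rightarrow> nat \<Rightarrow> nat set" where
  "cells_read w rk P st t =
     (\<Union>i<t. let st' = (step w rk P ^^ i) st in instr_reads (P ! pc st') st')"

definition cells_written ::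
  "nat \<Rightarrow> (nat \<Rightarrow> nat \<Rightarrow> nat) \<Rightarrow> program \<Rightarrow> state \<Rightarrow> nat \<Rightarrow> nat set" where
  "cells_written w rk P st t =
     (\<Union>i<t. let st' = (step w rk P ^^ i) st in instr_writes (P ! pc st') st')"

definition word_state :: "nat \<Rightarrow> state \<Rightarrow> bool" where
  "word_state w st \<longleftrightarrow> (\<forall>r. regs st r < 2 ^ w) \<and> (\<forall>a. mem st a < 2 ^ w)"


section \<open>Preprocessing and searching\<close>

text \<open>
  The alphabet is \<open>{..<\<sigma>}\<close>. The answers to rank queries outside the range of definition
  are arbitrary.
\<close>

definition rank_oracle :: "nat \<Rightarrow> nat list \<Rightarrow> (nat \<Rightarrow> nat \<Rightarrow> nat) \<Rightarrow> bool" where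
  "rank_oracle \<sigma> L rk \<longleftrightarrow> (\<forall>c<\<sigma>. \<forall>i\<le>length L. rk c i = rank c L i)"

text \<open>
  The orderings of a local ordering are stored as a table with \<open>\<sigma> + 1\<close> rows: first the one
  for the empty context, then the ones for the contexts \<open>0, \<dots>, \<sigma> - 1\<close>. Memory
  outside the table and registers other than 0 and 1 have arbitrary contents.
\<close>

definition preprocessing_input ::
  "nat \<Rightarrow> nat \<Rightarrow> nat \<Rightarrow> (nat list \<Rightarrow> nat list) \<Rightarrow> state \<Rightarrow> bool" where
  "preprocessing_input w \<sigma> n \<pi> st \<longleftrightarrow>
     word_state w st \<and> pc st = 0 \<and> regs st 0 = \<sigma> \<and> regs st 1 = n \<and>
     (\<forall>j<\<sigma>. mem st j = \<pi> [] ! j) \<and>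
     (\<forall>c<\<sigma>. \<forall>j<\<sigma>. mem st (\<sigma> * Suc c + j) = \<pi> [c] ! j)"

text \<open>
  The cells below \<open>D\<close> are those left behind in \<open>m\<close> by the preprocessing; the string
  \<open>x\<close> is stored from address \<open>D\<close> on. Everything else is arbitrary.
\<close>

definition query_input ::
  "nat \<Rightarrow> nat \<Rightarrow> nat \<Rightarrow> (nat \<Rightarrow> nat) \<Rightarrow> nat \<Rightarrow> nat list \<Rightarrow> state \<Rightarrow> bool" where
  "query_input w \<sigma> n m D x st \<longleftrightarrow>
     word_state w st \<and> pc st = 0 \<and> regs st 0 = \<sigma> \<and> regs st 1 = n \<and>
     regs st 2 = D \<and> regs st 3 = length x \<and>
     D + length x \<le> 2 ^ w \<and>
     (\<forall>a<D. mem st a = m a) \<and>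
     (\<forall>j<length x. mem st (D + j) = x ! j)"

text \<open>
  The program \<open>Q\<close> finds the rows prefixed by \<open>x\<close> in \<open>T\<close> steps, leaving the range in
  registers 4 and 5. The preprocessed cells below \<open>D\<close> are only read, and apart from them only
  the \<open>S\<close> cells from \<open>D\<close> on, which include those holding \<open>x\<close>, are used.
\<close>

definition computes_range ::
  "nat \<Rightarrow> (nat \<Rightarrow> nat \<Rightarrow> nat) \<Rightarrow> program \<Rightarrow> (nat list \<Rightarrow> nat list) \<Rightarrow> nat list \<Rightarrow> nat list
   \<Rightarrow> nat \<Rightarrow> nat \<Rightarrow> nat \<Rightarrow> state \<Rightarrow> bool" where
  "computes_range w rk Q \<pi> s x D T S st \<longleftrightarrow>
     (\<exists>t\<le>T. \<exists>st'. terminates w rk Q st t st' \<and>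
        is_row_range \<pi> s x (regs st' 4) (regs st' 5) \<and>
        cells_read w rk Q st t \<subseteq> {..<D + S} \<and>
        cells_written w rk Q st t \<subseteq> {D..<D + S})"

end

theory Submission
  imports Defs
begin

text \<open>
  Under a local ordering, prepending the same symbol \<open>c\<close> to two rotations that start with
  the same symbol \<open>d\<close> preserves their order. Hence the rows starting with \<open>c d\<close> appear in the
  same order as the rows that start with \<open>d\<close> and end with \<open>c\<close>, and if the rows prefixed by
  \<open>d y\<close> form the range \<open>[b, e)\<close>, then those prefixed by \<open>c d y\<close> form the range
  \<open>[o + rank c b, o + rank c e)\<close> with the offset \<open>o = pair_lo c d - rank c (first_lo d)\<close>; here
  \<open>first_lo d\<close> and \<open>pair_lo c d\<close> are the first rows starting with \<open>d\<close> and with \<open>c d\<close>.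
  Rows starting with \<open>c\<close> are grouped by their second symbol in the order \<open>\<pi> [c]\<close>, and the
  size of the group of \<open>c d\<close> is the number of \<open>c\<close> in the range of \<open>d\<close> in the transform, so two
  rank queries per pair of symbols suffice to tabulate all offsets. A query is a backward search
  with two rank queries per symbol.

  The rows are strings of length \<open>length s\<close> and not infinite periodic words, so longer patterns
  prefix no row and have to be treated separately.
\<close>

section \<open>Intervals and positions\<close>

text \<open>Apart from the empty case, \<open>A\<close> is all of \<open>{lo..Max A}\<close>, and
  counting gives the upper end.\<close>

lemma down_closed_eq_interval:
  fixes A :: "nat set"
  assumes "A \<subseteq> {lo..<hi}" "\<And>i j. lo \<le> i \<Longrightarrow> i \<le> j \<Longrightarrow> j \<in> A \<Longrightarrow> i \<in> A"
  shows "A = {lo..<lo + card A}"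
proof (cases "A = {}")
  case False
  have fin: "finite A" using assms(1) finite_subset by blast
  have "A = {lo..Max A}"
  proof
    show "A \<subseteq> {lo..Max A}" using assms(1) fin by auto
    show "{lo..Max A} \<subseteq> A" using assms(2) Max_in[OF fin False] by auto
  qed
  moreover have "lo \<le> Max A" using Max_in[OF fin False] assms(1) by auto
  moreover have "card {lo..Max A} = Suc (Max A) - lo" by simp
  ultimately have "lo + card A = Suc (Max A)" by simp
  then have "{lo..<lo + card A} = {lo..Max A}" by auto
  then show ?thesis using \<open>A = {lo..Max A}\<close> by simp
qed simp

text \<open>The elements with key below \<open>k\<close> form an initial segment whose size
  \<open>N k\<close> is the sum of the fibre sizes; a fibre is the difference of two consecutive
  such segments. The keys will be positions of symbols in an ordering.\<close>

lemma mono_fibre_eq_interval: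
  fixes key :: "nat \<Rightarrow> nat"
  assumes mono: "\<And>i j. lo \<le> i \<Longrightarrow> i \<le> j \<Longrightarrow> j < hi \<Longrightarrow> key i \<le> key j"
  defines "N \<equiv> \<lambda>k. \<Sum>j<k. card {i \<in> {lo..<hi}. key i = j}"
  shows "{i \<in> {lo..<hi}. key i = k} = {lo + N k..<lo + N (Suc k)}"
    and "N k \<le> hi - lo"
proof -
  have card: "card {i \<in> {lo..<hi}. key i < k} = N k" for k
  proof (induction k)
    case (Suc k)
    have "{i \<in> {lo..<hi}. key i < Suc k} =
        {i \<in> {lo..<hi}. key i < k} \<union> {i \<in> {lo..<hi}. key i = k}" by auto
    then show ?case using Suc by (simp add: N_def card_Un_disjoint disjoint_iff)
  qed (simp add: N_def)
  have below: "{i \<in> {lo..<hi}. key i < k} = {lo..<lo + N k}" for k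
    unfolding card[symmetric]
    by (rule down_closed_eq_interval[where hi = hi]) (use mono le_less_trans in fastforce)+
  have "{i \<in> {lo..<hi}. key i = k} =
      {i \<in> {lo..<hi}. key i < Suc k} - {i \<in> {lo..<hi}. key i < k}" by auto
  also have "\<dots> = {lo + N k..<lo + N (Suc k)}" unfolding below by auto
  finally show "{i \<in> {lo..<hi}. key i = k} = {lo + N k..<lo + N (Suc k)}" .
  have "card {i \<in> {lo..<hi}. key i < k} \<le> card {lo..<hi}" by (rule card_mono) auto
  then show "N k \<le> hi - lo" unfolding card by simp
qed

text \<open>An increasing bijection onto an interval maps the elements of \<open>A\<close> below a
  bound to an initial segment of equal size. So counting in \<open>A\<close>, later a difference of
  ranks, locates the image.\<close>

lemma strict_mono_on_image_interval:
  fixes f :: "nat \<Rightarrow> nat"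
  assumes "finite A" "strict_mono_on A f" "f ` A = {p..<q}"
  shows "f ` {i \<in> A. b \<le> i \<and> i < e} =
    {p + card {i \<in> A. i < b}..<p + card {i \<in> A. i < e}}"
proof -
  have inj: "inj_on f A" by (rule strict_mono_on_imp_inj_on[OF assms(2)])
  have below: "f ` {i \<in> A. i < b} = {p..<p + card {i \<in> A. i < b}}" for b
  proof -
    let ?B = "{i \<in> A. i < b}"
    have "card (f ` ?B) = card ?B" by (rule card_image) (rule inj_on_subset[OF inj], auto)
    moreover have "f ` ?B = {p..<p + card (f ` ?B)}"
    proof (rule down_closed_eq_interval[where hi = q])
      show "f ` ?B \<subseteq> {p..<q}" using assms(3) by auto
      fix i j assume ij: "p \<le> i" "i \<le> j" "j \<in> f ` ?B"
      then obtain j' where j': "j = f j'" "j' \<in> A" "j' < b" by auto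
      have "j < q" using j' assms(3) by auto
      then have "i \<in> f ` A" using ij unfolding assms(3) by simp
      then obtain i' where i': "i = f i'" "i' \<in> A" by auto
      have "\<not> j' < i'" using strict_mono_onD[OF assms(2) j'(2) i'(2)] i' j' ij by auto
      then show "i \<in> f ` ?B" using i' j' by auto
    qed
    ultimately show ?thesis by simp
  qed
  have "{i \<in> A. b \<le> i \<and> i < e} = {i \<in> A. i < e} - {i \<in> A. i < b}" by auto
  then have "f ` {i \<in> A. b \<le> i \<and> i < e} = f ` {i \<in> A. i < e} - f ` {i \<in> A. i < b}"
    using inj_on_image_set_diff[OF inj, of "{i \<in> A. i < e}" "{i \<in> A. i < b}"] by auto
  then show ?thesis unfolding below by auto
qed

section \<open>Rank as counting, and positions in an ordering\<close>

lemma rank_conv_card: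
  assumes "i \<le> length L"
  shows "rank c L i = card {j. j < i \<and> L ! j = c}"
proof -
  have "{j. j < length (take i L) \<and> take i L ! j = c} = {j. j < i \<and> L ! j = c}"
    using assms by auto
  then show ?thesis
    unfolding rank_def count_list_eq_length_filter length_filter_conv_card
    by (simp add: eq_commute[of c])
qed

lemma rank_split:
  assumes "b \<le> e" "e \<le> length L"
  shows "rank c L e = rank c L b + card {j \<in> {b..<e}. L ! j = c}"
proof -
  have "{j. j < e \<and> L ! j = c} = {j. j < b \<and> L ! j = c} \<union> {j \<in> {b..<e}. L ! j = c}"
    using assms by auto
  moreover have "card ({j. j < b \<and> L ! j = c} \<union> {j \<in> {b..<e}. L ! j = c}) =
      card {j. j < b \<and> L ! j = c} + card {j \<in> {b..<e}. L ! j = c}"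
    by (rule card_Un_disjoint) auto
  ultimately show ?thesis using assms by (simp add: rank_conv_card)
qed

lemma rank_mono: "b \<le> e \<Longrightarrow> e \<le> length L \<Longrightarrow> rank c L b \<le> rank c L e"
  using rank_split[of b e L c] by simp

lemma rank_le_length: "rank c L i \<le> length L"
proof -
  have "count_list (take i L) c \<le> length (take i L)" by (rule count_le_length)
  then show ?thesis by (simp add: rank_def)
qed

text \<open>Used as a numeric sort key: sortedness by an ordering becomes monotonicity of
  positions.\<close>

definition position :: "'a list \<Rightarrow> 'a \<Rightarrow> nat" where
  "position xs a = (LEAST i. i < length xs \<and> xs ! i = a)"

lemma position_nth: "distinct xs \<Longrightarrow> i < length xs \<Longrightarrow> position xs (xs ! i) = i"
  unfolding position_def by (rule Least_equality) (auto simp: nth_eq_iff_index_eq)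

lemma position_less_length: "a \<in> set xs \<Longrightarrow> position xs a < length xs"
  and nth_position: "a \<in> set xs \<Longrightarrow> xs ! position xs a = a"
  unfolding position_def in_set_conv_nth by (metis (mono_tags, lifting) LeastI)+

lemma precedes_position_less:
  "distinct xs \<Longrightarrow> precedes xs a b \<Longrightarrow> position xs a < position xs b"
  unfolding precedes_def using position_nth by (metis order.strict_trans)

text \<open>\<open>rotate1\<close> sends both sides to \<open>u\<close> and is injective. This keeps
  the last-to-first map within the rotations.\<close>

lemma last_butlast_eq_rotate:
  assumes "u \<noteq> []"
  shows "last u # butlast u = rotate (length u - 1) u"
proof -
  have "rotate1 (rotate (length u - 1) u) = u"
    using assms by (simp flip: rotate_Suc)
  then have "rotate1 (rotate (length u - 1) u) = rotate1 (last u # butlast u)"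
    using assms by simp
  then show ?thesis using injD[OF inj_rotate1] by metis
qed

section \<open>The order of the rows\<close>

locale local_bwt =
  fixes \<sigma> :: nat and s :: "nat list" and \<pi> :: "nat list \<Rightarrow> nat list"
  assumes symbols: "set s \<subseteq> {..<\<sigma>}"
    and prim: "primitive s"
    and orderings: "context_orderings {..<\<sigma>} \<pi>"
    and local: "local_ordering {..<\<sigma>} \<pi>"
begin

abbreviation "n \<equiv> length s"
abbreviation "M \<equiv> ctx_matrix \<pi> s"
abbreviation "L \<equiv> ctx_bwt \<pi> s"

lemma is_ctx_matrix_M: "is_ctx_matrix \<pi> s M"
  unfolding ctx_matrix_def by (rule theI') (rule ex1_ctx_matrix[OF orderings symbols])

lemma mset_M: "mset M = mset (rotations s)"
  using is_ctx_matrix_M by (simp add: is_ctx_matrix_def)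

lemma length_M [simp]: "length M = n"
  using mset_eq_length[OF mset_M] by (simp add: rotations_def)

lemma length_L [simp]: "length L = n"
  by (simp add: ctx_bwt_def)

lemma distinct_M: "distinct M"
  using prim mset_eq_imp_distinct_iff[OF mset_M] by (simp add: primitive_def)

lemma set_M: "s \<noteq> [] \<Longrightarrow> set M = range (\<lambda>i. rotate i s)"
proof -
  assume "s \<noteq> []"
  then have "rotate i s \<in> (\<lambda>i. rotate i s) ` {0..<n}" for i
    by (intro image_eqI[of _ _ "i mod n"]) (use rotate_conv_mod[of i s] in auto)
  moreover have "set M = (\<lambda>i. rotate i s) ` {0..<n}"
    using mset_eq_setD[OF mset_M] by (simp add: rotations_def)
  ultimately show ?thesis by auto
qed

lemma row_eq_rotate: "i < n \<Longrightarrow> \<exists>k. M ! i = rotate k s"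
  using set_M nth_mem[of i M] by (cases "s = []") auto

lemma length_row [simp]: "i < n \<Longrightarrow> length (M ! i) = n"
  using row_eq_rotate[of i] by auto

lemma row_not_Nil: "i < n \<Longrightarrow> M ! i \<noteq> []"
  using length_row[of i] by (metis list.size(3) not_less_zero)

lemma row_symbols: "i < n \<Longrightarrow> set (M ! i) \<subseteq> {..<\<sigma>}"
  using row_eq_rotate[of i] symbols by auto

lemma row_eq_iff: "i < n \<Longrightarrow> j < n \<Longrightarrow> M ! i = M ! j \<longleftrightarrow> i = j"
  using nth_eq_iff_index_eq[OF distinct_M] by simp

lemma nth_L: "i < n \<Longrightarrow> L ! i = last (M ! i)"
  by (simp add: ctx_bwt_def)

lemma ctx_less_rows: "i < j \<Longrightarrow> j < n \<Longrightarrow> ctx_less \<pi> (M ! i) (M ! j)"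
  using is_ctx_matrix_M sorted_wrt_nth_less[of _ M i j] row_eq_iff[of i j]
  unfolding is_ctx_matrix_def by fastforce

lemma ctx_less_rowsD:
  assumes "i < n" "j < n" "i \<noteq> j" "ctx_less \<pi> (M ! i) (M ! j)"
  shows "i < j"
proof (rule ccontr)
  assume "\<not> i < j"
  then have "ctx_less \<pi> (M ! j) (M ! i)" using assms ctx_less_rows by simp
  moreover have "\<not> ctx_less \<pi> (M ! j) (M ! i)"
    using assms row_symbols row_eq_iff by (intro ctx_less_asym[OF orderings]) auto
  ultimately show False by simp
qed

lemma ordering_distinct: "set x \<subseteq> {..<\<sigma>} \<Longrightarrow> distinct (\<pi> x)"
  and ordering_set: "set x \<subseteq> {..<\<sigma>} \<Longrightarrow> set (\<pi> x) = {..<\<sigma>}"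
  using orderings by (auto simp: context_orderings_def)

lemma ordering_length: "set x \<subseteq> {..<\<sigma>} \<Longrightarrow> length (\<pi> x) = \<sigma>"
  using distinct_card[of "\<pi> x"] ordering_distinct ordering_set by simp

section \<open>The last-to-first mapping\<close>

definition LF :: "nat \<Rightarrow> nat" where
  "LF i = (THE j. j < n \<and> M ! j = last (M ! i) # butlast (M ! i))"

text \<open>Existence: moving the last symbol to the front gives a rotation again. Uniqueness:
  \<open>s\<close> is primitive, so the rows are distinct.\<close>

lemma LF:
  assumes "i < n"
  shows "LF i < n" "M ! LF i = last (M ! i) # butlast (M ! i)"
proof -
  have ne: "s \<noteq> []" using assms by auto
  obtain k where "M ! i = rotate k s" using row_eq_rotate assms by blast
  then have "last (M ! i) # butlast (M ! i) = rotate (n - 1 + k) s"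
    using ne last_butlast_eq_rotate[of "M ! i"] by (simp add: rotate_rotate)
  then obtain j where j: "j < n" "M ! j = last (M ! i) # butlast (M ! i)"
    using set_M[OF ne] by (metis in_set_conv_nth length_M rangeI)
  then have "\<exists>!j. j < n \<and> M ! j = last (M ! i) # butlast (M ! i)"
    using row_eq_iff by metis
  from theI'[OF this] show "LF i < n" "M ! LF i = last (M ! i) # butlast (M ! i)"
    unfolding LF_def by auto
qed

lemma LF_inj: "inj_on LF {..<n}"
proof (rule inj_onI)
  fix i j assume "i \<in> {..<n}" "j \<in> {..<n}" "LF i = LF j"
  then have "M ! i = M ! j"
    using LF(2)[of i] LF(2)[of j] row_not_Nil[of i] row_not_Nil[of j] append_butlast_last_id
    by (metis lessThan_iff list.inject)
  then show "i = j" using row_eq_iff \<open>i \<in> {..<n}\<close> \<open>j \<in> {..<n}\<close> by simp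
qed

lemma LF_surj: "LF ` {..<n} = {..<n}"
  by (rule endo_inj_surj[OF _ _ LF_inj]) (use LF in auto)

text \<open>\<open>LF\<close> permutes the rows, so a set of rows can be described and counted
  through its preimage.\<close>

lemma LF_image_Collect: "LF ` {i. i < n \<and> Q (LF i)} = {i. i < n \<and> Q i}"
proof -
  have "{i. i < n \<and> Q i} = {i \<in> LF ` {..<n}. Q i}" unfolding LF_surj by auto
  then show ?thesis by auto
qed

text \<open>The common prefix is nonempty, so prepending a symbol does not change its last symbol, hence
  neither the ordering that decides.\<close>

lemma LF_strict_mono:
  assumes ij: "i < j" "j < n" and hd: "hd (M ! i) = hd (M ! j)" and L: "L ! i = L ! j"
  shows "LF i < LF j"
proof -
  have i: "i < n" using ij by simp
  define u v x where "u = M ! i" and "v = M ! j" and "x = longest_common_prefix u v"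
  have ne: "u \<noteq> []" "v \<noteq> []" "u \<noteq> v" and len: "length u = n" "length v = n"
    using ij i row_not_Nil row_eq_iff unfolding u_def v_def by auto
  have last: "last u = last v" using L ij i by (simp add: nth_L u_def v_def)
  \<comment> \<open>Both rows end with the same symbol, so they already differ before it.\<close>
  have bl: "butlast u \<noteq> butlast v" using ne last by (metis append_butlast_last_id)
  \<comment> \<open>Dropping the equal last symbols changes neither the common prefix nor the two
    symbols after it.\<close>
  have lcp: "longest_common_prefix (butlast u) (butlast v) = x \<and> length x < n - 1 \<and>
     butlast u ! length x = u ! length x \<and> butlast v ! length x = v ! length x"
  proof -
    have gen: "longest_common_prefix (a @ [c]) (b @ [c]) = longest_common_prefix a b \<and>
        length (longest_common_prefix a b) < length a"
      if "length a = length b" "a \<noteq> b" for a b :: "nat list" and c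
      using that by (induction a b rule: list_induct2) auto
    have "longest_common_prefix u v = longest_common_prefix (butlast u) (butlast v) \<and>
        length (longest_common_prefix (butlast u) (butlast v)) < length (butlast u)"
      using gen[of "butlast u" "butlast v" "last u"] bl len ne last
      by (metis append_butlast_last_id length_butlast)
    then show ?thesis using len by (simp add: x_def nth_butlast)
  qed
  have less: "precedes (\<pi> x) (u ! length x) (v ! length x)"
    using ctx_less_rows[OF ij] by (simp add: ctx_less_def Let_def u_def v_def x_def)
  have x: "x \<noteq> []" using ne hd unfolding x_def u_def[symmetric] v_def[symmetric]
    by (cases u; cases v) auto
  have "set u \<subseteq> {..<\<sigma>}" using row_symbols[OF i] by (simp add: u_def)
  moreover have "set x \<subseteq> set u"
    unfolding x_def by (rule set_mono_prefix) (rule longest_common_prefix_prefix1)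
  moreover have "last u \<in> set u" using ne by simp
  ultimately have "last u # x \<in> lists {..<\<sigma>}" "x \<in> lists {..<\<sigma>}" by auto
  moreover have "last (last u # x) = last x" using x by simp
  ultimately have "\<pi> (last u # x) = \<pi> x"
    using local x unfolding local_ordering_def by blast
  \<comment> \<open>The two new rows have common prefix \<open>last u # x\<close> and then differ in
    the same two symbols as before.\<close>
  then have "ctx_less \<pi> (M ! LF i) (M ! LF j)"
    using less lcp LF(2)[OF i] LF(2)[OF ij(2)] last
    by (simp add: ctx_less_def Let_def flip: u_def v_def)
  moreover have "LF i \<noteq> LF j" using inj_onD[OF LF_inj, of i j] ij i by auto
  ultimately show ?thesis using ctx_less_rowsD LF(1) i ij(2) by blast
qed

section \<open>Groups of rows by their first one or two symbols\<close>

definition first_sum :: "nat \<Rightarrow> nat" where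
  "first_sum k = (\<Sum>j<k. rank (\<pi> [] ! j) L n)"

definition first_lo :: "nat \<Rightarrow> nat" where
  "first_lo d = first_sum (position (\<pi> []) d)"

definition first_hi :: "nat \<Rightarrow> nat" where
  "first_hi d = first_sum (Suc (position (\<pi> []) d))"

text \<open>A difference of ranks, as a program can compute it. For rows of length at least two,
  \<open>card_pair\<close> identifies it with the number of rows that start with
  \<open>c d\<close>.\<close>

definition pair_count :: "nat \<Rightarrow> nat \<Rightarrow> nat" where
  "pair_count c d = rank c L (first_hi d) - rank c L (first_lo d)"

definition pair_sum :: "nat \<Rightarrow> nat \<Rightarrow> nat" where
  "pair_sum c k = first_lo c + (\<Sum>j<k. pair_count c (\<pi> [c] ! j))"

definition pair_lo :: "nat \<Rightarrow> nat \<Rightarrow> nat" where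
  "pair_lo c d = pair_sum c (position (\<pi> [c]) d)"

text \<open>\<open>LF\<close> maps the rows that end with \<open>d\<close> bijectively to those that
  start with \<open>d\<close>.\<close>

lemma card_first: "card {i. i < n \<and> hd (M ! i) = d} = rank d L n"
proof -
  have "{i. i < n \<and> hd (M ! i) = d} = LF ` {i. i < n \<and> hd (M ! LF i) = d}"
    by (rule LF_image_Collect[symmetric])
  also have "{i. i < n \<and> hd (M ! LF i) = d} = {i. i < n \<and> L ! i = d}"
    using LF(2) nth_L by auto
  also have "card (LF ` \<dots>) = card {i. i < n \<and> L ! i = d}"
    by (rule card_image) (rule inj_on_subset[OF LF_inj], auto)
  finally show ?thesis by (simp add: rank_conv_card)
qed

lemma hd_row_less: "i < n \<Longrightarrow> hd (M ! i) < \<sigma>"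
  using row_symbols[of i] row_not_Nil[of i] by (meson hd_in_set in_mono lessThan_iff)

lemma first_fibre:
  assumes "k < \<sigma>"
  shows "{i. i < n \<and> hd (M ! i) = \<pi> [] ! k} = {i \<in> {0..<n}. position (\<pi> []) (hd (M ! i)) = k}"
  using assms hd_row_less nth_position[of _ "\<pi> []"] position_nth[of "\<pi> []" k]
    ordering_distinct[of "[]"] ordering_set[of "[]"] ordering_length[of "[]"]
  by auto

text \<open>Rows with different first symbols have an empty common prefix, so
  \<open>\<pi> []\<close> decides.\<close>

lemma first_key_mono:
  assumes "i \<le> j" "j < n"
  shows "position (\<pi> []) (hd (M ! i)) \<le> position (\<pi> []) (hd (M ! j))"
proof (cases "hd (M ! i) = hd (M ! j)")
  case False
  then have "i < j" using assms by (cases "i = j") auto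
  have "precedes (\<pi> []) (hd (M ! i)) (hd (M ! j))"
    using ctx_less_rows[OF \<open>i < j\<close> assms(2)] False row_not_Nil[of i] row_not_Nil[of j] assms
    by (cases "M ! i"; cases "M ! j") (auto simp: ctx_less_Cons)
  then show ?thesis using precedes_position_less[OF ordering_distinct[of "[]"]] by fastforce
qed simp

lemma first_sum_conv:
  assumes "k \<le> \<sigma>"
  shows "first_sum k = (\<Sum>j<k. card {i \<in> {0..<n}. position (\<pi> []) (hd (M ! i)) = j})"
proof -
  have "rank (\<pi> [] ! j) L n = card {i \<in> {0..<n}. position (\<pi> []) (hd (M ! i)) = j}"
    if "j < k" for j
    unfolding card_first[symmetric] using that assms by (subst first_fibre) auto
  then show ?thesis unfolding first_sum_def by simp
qed

lemma first_sum_le: "k \<le> \<sigma> \<Longrightarrow> first_sum k \<le> n"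
  unfolding first_sum_conv
  using mono_fibre_eq_interval(2)[of 0 n "\<lambda>i. position (\<pi> []) (hd (M ! i))" k] first_key_mono
  by simp

lemma position_first: "d < \<sigma> \<Longrightarrow> position (\<pi> []) d < \<sigma>" "d < \<sigma> \<Longrightarrow> \<pi> [] ! position (\<pi> []) d = d"
  using position_less_length[of d "\<pi> []"] nth_position[of d "\<pi> []"] ordering_set[of "[]"]
    ordering_length[of "[]"] by auto

lemma first_range:
  assumes "d < \<sigma>"
  shows "{i. i < n \<and> hd (M ! i) = d} = {first_lo d..<first_hi d}"
  using first_fibre[of "position (\<pi> []) d"] position_first[OF assms]
    mono_fibre_eq_interval(1)[of 0 n "\<lambda>i. position (\<pi> []) (hd (M ! i))" "position (\<pi> []) d"]
    first_key_mono
  by (simp add: first_lo_def first_hi_def first_sum_conv)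

lemma first_bounds: "first_lo d \<le> first_hi d" "d < \<sigma> \<Longrightarrow> first_hi d \<le> n"
  using position_first[of d] first_sum_le[of "Suc (position (\<pi> []) d)"]
  by (auto simp: first_lo_def first_hi_def first_sum_def)

lemma pair_count_eq_card:
  assumes "d < \<sigma>"
  shows "pair_count c d = card {i \<in> {first_lo d..<first_hi d}. L ! i = c}"
  using rank_split[of "first_lo d" "first_hi d" L c] first_bounds[of d] assms
  by (simp add: pair_count_def)

text \<open>The second symbol of row \<open>LF i\<close> is the first of row \<open>i\<close>;
  length 1 would leave no second symbol.\<close>

lemma LF_image_pair:
  assumes "2 \<le> n" "d < \<sigma>"
  shows "LF ` {i \<in> {first_lo d..<first_hi d}. L ! i = c} =
    {i. i < n \<and> hd (M ! i) = c \<and> M ! i ! 1 = d}"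
proof -
  have "M ! LF i ! 1 = hd (M ! i)" if "i < n" for i
    using LF(2)[OF that] length_row[OF that] assms(1) by (cases "M ! i") auto
  then have "{i \<in> {first_lo d..<first_hi d}. L ! i = c} =
      {i. i < n \<and> (hd (M ! LF i) = c \<and> M ! LF i ! 1 = d)}"
    using LF(2) nth_L unfolding first_range[OF assms(2), symmetric] by auto
  then show ?thesis using LF_image_Collect[of "\<lambda>i. hd (M ! i) = c \<and> M ! i ! 1 = d"] by simp
qed

lemma card_pair:
  assumes "2 \<le> n" "d < \<sigma>"
  shows "card {i. i < n \<and> hd (M ! i) = c \<and> M ! i ! 1 = d} = pair_count c d"
  unfolding LF_image_pair[OF assms, symmetric] pair_count_eq_card[OF assms(2)]
  by (rule card_image, rule inj_on_subset[OF LF_inj]) (use first_bounds assms(2) in fastforce)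

lemma pair_fibre:
  assumes "2 \<le> n" "c < \<sigma>" "k < \<sigma>"
  shows "{i. i < n \<and> hd (M ! i) = c \<and> M ! i ! 1 = \<pi> [c] ! k} =
    {i \<in> {first_lo c..<first_hi c}. position (\<pi> [c]) (M ! i ! 1) = k}"
proof -
  have c: "set [c] \<subseteq> {..<\<sigma>}" using assms by simp
  have "M ! i ! 1 < \<sigma>" if "i < n" for i
    using row_symbols[OF that] nth_mem[of 1 "M ! i"] length_row[OF that] assms(1)
    by (auto simp del: nth_mem)
  then have "M ! i ! 1 = \<pi> [c] ! k \<longleftrightarrow> position (\<pi> [c]) (M ! i ! 1) = k" if "i < n" for i
    using that assms nth_position[of _ "\<pi> [c]"] position_nth[of "\<pi> [c]" k]
      ordering_distinct[OF c] ordering_set[OF c] ordering_length[OF c] by auto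
  then show ?thesis unfolding first_range[OF assms(2), symmetric] by auto
qed

text \<open>Rows that start with \<open>c\<close> and differ in the second symbol have common prefix
  \<open>[c]\<close>, so \<open>\<pi> [c]\<close> decides.\<close>

lemma pair_key_mono:
  assumes "2 \<le> n" "c < \<sigma>" "first_lo c \<le> i" "i \<le> j" "j < first_hi c"
  shows "position (\<pi> [c]) (M ! i ! 1) \<le> position (\<pi> [c]) (M ! j ! 1)"
proof (cases "M ! i ! 1 = M ! j ! 1")
  case False
  then have "i < j" using assms by (cases "i = j") auto
  have "i \<in> {i. i < n \<and> hd (M ! i) = c}" "j \<in> {i. i < n \<and> hd (M ! i) = c}"
    using assms unfolding first_range[OF assms(2)] by auto
  then have ij: "i < n" "j < n" "hd (M ! i) = c" "hd (M ! j) = c" by auto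
  obtain a u b v where "M ! i = c # a # u" "M ! j = c # b # v"
    using ij length_row[of i] length_row[of j] assms(1)
    by (metis One_nat_def Suc_le_length_iff list.sel(1) numeral_2_eq_2)
  then have "precedes (\<pi> [c]) (M ! i ! 1) (M ! j ! 1)"
    using ctx_less_rows[OF \<open>i < j\<close> ij(2)] False by (auto simp: ctx_less_Cons)
  then show ?thesis
    using precedes_position_less[OF ordering_distinct[of "[c]"]] assms(2) by fastforce
qed simp

lemma pair_sum_conv:
  assumes "2 \<le> n" "c < \<sigma>" "k \<le> \<sigma>"
  shows "pair_sum c k = first_lo c +
    (\<Sum>j<k. card {i \<in> {first_lo c..<first_hi c}. position (\<pi> [c]) (M ! i ! 1) = j})"
proof -
  have "\<pi> [c] ! j < \<sigma>" if "j < k" for j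
    using that assms ordering_set[of "[c]"] ordering_length[of "[c]"] nth_mem[of j "\<pi> [c]"] by auto
  then have "pair_count c (\<pi> [c] ! j) =
      card {i \<in> {first_lo c..<first_hi c}. position (\<pi> [c]) (M ! i ! 1) = j}"
    if "j < k" for j
    using that assms card_pair[of "\<pi> [c] ! j" c] pair_fibre[of c j] by simp
  then show ?thesis unfolding pair_sum_def by simp
qed

text \<open>Among the rows of \<open>c\<close> the second symbol is sorted by
  \<open>\<pi> [c]\<close>, so its fibres are consecutive intervals whose sizes
  \<open>pair_sum\<close> adds up. The bound by \<open>first_hi c\<close> keeps the range found by a
  backward step inside the rows of \<open>c\<close>.\<close>

lemma pair_range:
  assumes "2 \<le> n" "c < \<sigma>" "d < \<sigma>"
  shows "{i. i < n \<and> hd (M ! i) = c \<and> M ! i ! 1 = d} =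
      {pair_lo c d..<pair_lo c d + pair_count c d}"
    and "pair_lo c d + pair_count c d \<le> first_hi c"
proof -
  let ?k = "position (\<pi> [c]) d"
  have c: "set [c] \<subseteq> {..<\<sigma>}" using assms by simp
  have k: "?k < \<sigma>" "\<pi> [c] ! ?k = d"
    using position_less_length[of d "\<pi> [c]"] nth_position[of d "\<pi> [c]"] ordering_set[OF c]
      ordering_length[OF c] assms by auto
  have suc: "pair_sum c (Suc ?k) = pair_lo c d + pair_count c d"
    using k by (simp add: pair_sum_def pair_lo_def)
  show "{i. i < n \<and> hd (M ! i) = c \<and> M ! i ! 1 = d} =
      {pair_lo c d..<pair_lo c d + pair_count c d}"
    unfolding suc[symmetric]
    using pair_fibre[OF assms(1,2) k(1)] k
      mono_fibre_eq_interval(1)[of "first_lo c" "first_hi c" "\<lambda>i. position (\<pi> [c]) (M ! i ! 1)" ?k]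
      pair_key_mono[OF assms(1,2)]
    by (simp add: pair_lo_def pair_sum_conv[OF assms(1,2)])
  have "pair_sum c (Suc ?k) \<le> first_hi c"
    using pair_sum_conv[OF assms(1,2), of "Suc ?k"] k(1) first_bounds(1)[of c]
      mono_fibre_eq_interval(2)[of "first_lo c" "first_hi c" "\<lambda>i. position (\<pi> [c]) (M ! i ! 1)" "Suc ?k"]
      pair_key_mono[OF assms(1,2)]
    by simp
  then show "pair_lo c d + pair_count c d \<le> first_hi c" using suc by simp
qed

lemma first_lo_le_pair_lo: "first_lo c \<le> pair_lo c d"
  by (simp add: pair_lo_def pair_sum_def)

section \<open>The backward search step\<close>

lemma prefix_Cons_row_LF:
  assumes "i < n" "length x < n"
  shows "prefix (c # x) (M ! LF i) \<longleftrightarrow> L ! i = c \<and> prefix x (M ! i)"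
proof -
  \<comment> \<open>Since \<open>x\<close> is shorter than a row, cutting the last symbol off row
    \<open>i\<close> does not affect whether \<open>x\<close> is a prefix.\<close>
  have "prefix x (butlast (M ! i)) \<longleftrightarrow> prefix x (M ! i)"
    using assms length_row[OF assms(1)] row_not_Nil[OF assms(1)]
      prefix_snoc[of x "butlast (M ! i)" "last (M ! i)"] by auto
  then show ?thesis using LF(2)[OF assms(1)] nth_L[OF assms(1)] by auto
qed

text \<open>For an empty range \<open>is_row_range\<close> leaves its place open. The rank
  differences in \<open>backward_step\<close> need both ends inside the rows of the first symbol, so
  this is carried along.\<close>

definition first_bounded_range :: "nat list \<Rightarrow> nat \<Rightarrow> nat \<Rightarrow> bool" where
  "first_bounded_range x b e \<longleftrightarrow> is_row_range \<pi> s x b e \<and> first_lo (hd x) \<le> b \<and> e \<le> first_hi (hd x)"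

lemma singleton_range:
  assumes "d < \<sigma>"
  shows "first_bounded_range [d] (first_lo d) (first_hi d)"
proof -
  have "prefix [d] (M ! i) \<longleftrightarrow> hd (M ! i) = d" if "i < n" for i
    using row_not_Nil[OF that] by (cases "M ! i") auto
  then show ?thesis
    using first_bounds[of d] assms first_range[OF assms]
    by (auto simp: is_row_range_def first_bounded_range_def)
qed

text \<open>On the rows that start with \<open>d\<close> and end with \<open>c\<close>,
  \<open>LF\<close> is increasing and maps onto the rows that start with \<open>c d\<close>.
  Counting these rows below \<open>b\<close> and below \<open>e\<close> gives the ends of the new
  range.\<close>

lemma backward_step:
  assumes len: "length (d # y) < n" and c: "c < \<sigma>" and d: "d < \<sigma>"
    and range: "first_bounded_range (d # y) b e"
  shows "first_bounded_range (c # d # y)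
    (pair_lo c d + rank c L b - rank c L (first_lo d))
    (pair_lo c d + rank c L e - rank c L (first_lo d))"
proof -
  have be: "first_lo d \<le> b" "b \<le> e" "e \<le> first_hi d" "first_hi d \<le> n"
    and rows: "{i. i < n \<and> prefix (d # y) (M ! i)} = {b..<e}"
    using range first_bounds(2)[OF d] by (auto simp: first_bounded_range_def is_row_range_def)
  have n: "2 \<le> n" using len by simp
  define A where "A = {i \<in> {first_lo d..<first_hi d}. L ! i = c}"
  have below: "card {i \<in> A. i < k} = rank c L k - rank c L (first_lo d)"
    if "first_lo d \<le> k" "k \<le> first_hi d" for k
  proof -
    have "{i \<in> A. i < k} = {i \<in> {first_lo d..<k}. L ! i = c}" using that by (auto simp: A_def)
    then show ?thesis using rank_split[of "first_lo d" k L c] that be by simp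
  qed
  have mono: "strict_mono_on A LF"
  proof (rule strict_mono_onI)
    fix i j assume "i \<in> A" "j \<in> A" "i < j"
    moreover from this have "i \<in> {first_lo d..<first_hi d}" "j \<in> {first_lo d..<first_hi d}"
      by (auto simp: A_def)
    then have "hd (M ! i) = d" "hd (M ! j) = d" "j < n"
      unfolding first_range[OF d, symmetric] by auto
    ultimately show "LF i < LF j" using LF_strict_mono[of i j] by (simp add: A_def)
  qed
  have image: "LF ` A = {pair_lo c d..<pair_lo c d + pair_count c d}"
    using LF_image_pair[OF n d, of c] pair_range(1)[OF n c d] by (simp add: A_def)
  have "{i. i < n \<and> prefix (c # d # y) (M ! i)} =
      LF ` {i. i < n \<and> prefix (c # d # y) (M ! LF i)}"
    by (rule LF_image_Collect[symmetric])
  \<comment> \<open>Row \<open>LF i\<close> starts with \<open>c d y\<close> iff row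
    \<open>i\<close> ends with \<open>c\<close> and starts with \<open>d y\<close>, that is, lies in
    \<open>[b, e)\<close>.\<close>
  also have "{i. i < n \<and> prefix (c # d # y) (M ! LF i)} = {i \<in> A. b \<le> i \<and> i < e}"
  proof -
    have "{i. i < n \<and> prefix (c # d # y) (M ! LF i)} =
        {i. i < n \<and> prefix (d # y) (M ! i)} \<inter> {i. L ! i = c}"
      using prefix_Cons_row_LF[OF _ len] by blast
    also have "\<dots> = {i \<in> A. b \<le> i \<and> i < e}" unfolding rows using be by (auto simp: A_def)
    finally show ?thesis .
  qed
  also have "LF ` \<dots> = {pair_lo c d + (rank c L b - rank c L (first_lo d))..<
      pair_lo c d + (rank c L e - rank c L (first_lo d))}"
    (is "_ = ?R")
  proof -
    have "finite A" by (simp add: A_def)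
    from strict_mono_on_image_interval[OF this mono image, of b e] show ?thesis
      using below[of b] below[of e] be by simp
  qed
  finally have rows': "{i. i < n \<and> prefix (c # d # y) (M ! i)} = ?R" .
  \<comment> \<open>The rank at \<open>first_lo d\<close> is the smallest of the four, so no
    subtraction truncates.\<close>
  have ranks: "rank c L (first_lo d) \<le> rank c L b" "rank c L b \<le> rank c L e"
    "rank c L e \<le> rank c L (first_hi d)"
    using be by (auto intro: rank_mono)
  have le: "first_lo c \<le> pair_lo c d" "pair_lo c d + pair_count c d \<le> first_hi c" "first_hi c \<le> n"
    using first_lo_le_pair_lo pair_range(2)[OF n c d] first_bounds(2)[OF c] by auto
  then have "pair_lo c d + (rank c L e - rank c L (first_lo d)) \<le> first_hi c"
    using ranks unfolding pair_count_def by linarith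
  moreover have "first_lo c \<le> pair_lo c d + rank c L b - rank c L (first_lo d)"
    "pair_lo c d + rank c L b - rank c L (first_lo d) \<le>
      pair_lo c d + rank c L e - rank c L (first_lo d)"
    using ranks le by linarith+
  ultimately show ?thesis
    using rows' ranks le by (simp add: first_bounded_range_def is_row_range_def)
qed

end

text \<open>With \<open>q = w div Suc m\<close>, \<open>w\<close> is below
  \<open>Suc m * Suc q\<close>, so the left side is below \<open>Suc q ^ Suc m\<close> as soon as
  \<open>q\<close> is at least \<open>C * Suc m ^ m\<close>; and
  \<open>Suc q \<le> 2 ^ q\<close>.\<close>

lemma eventually_power_less_two_power:
  fixes C m :: nat
  shows "\<exists>w\<^sub>0. \<forall>w\<ge>w\<^sub>0. C * w ^ m < 2 ^ w"
proof (intro exI allI impI)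
  fix w :: nat
  define q where "q = w div Suc m"
  \<comment> \<open>This assumption fixes the witness for \<open>w\<^sub>0\<close>: dividing it by
    \<open>Suc m\<close> leaves the constant that \<open>q\<close> has to reach.\<close>
  assume "Suc m * (C * Suc m ^ m) \<le> w"
  then have q: "C * Suc m ^ m \<le> q"
    unfolding q_def by (metis div_le_mono nonzero_mult_div_cancel_left nat.distinct(1))
  have w: "w < Suc m * Suc q" "Suc m * q \<le> w"
    unfolding q_def using dividend_less_times_div[of "Suc m" w] times_div_less_eq_dividend[of "Suc m" w]
    by (auto simp only: mult_Suc_right)
  have "C * w ^ m \<le> C * (Suc m * Suc q) ^ m" using w(1) by (intro mult_le_mono power_mono) auto
  also have "\<dots> = C * Suc m ^ m * Suc q ^ m" by (simp only: power_mult_distrib mult.assoc)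
  also have "\<dots> < Suc q * Suc q ^ m" using q by (intro mult_strict_right_mono) auto
  also have "\<dots> = Suc q ^ Suc m" by simp
  also have "\<dots> \<le> (2 ^ q) ^ Suc m"
    by (rule power_mono) (simp_all add: Suc_leI)
  also have "\<dots> = 2 ^ (Suc m * q)" by (simp only: power_mult[symmetric] mult.commute)
  also have "\<dots> \<le> 2 ^ w" using w(2) by (intro power_increasing) auto
  finally show "C * w ^ m < 2 ^ w" .
qed

section \<open>Reasoning about programs\<close>

text \<open>The exact number of steps is an argument, so a straight-line segment is executed
  symbolically by unfolding with \<open>runs_numeral\<close>. The sets \<open>R\<close> and
  \<open>W\<close> confine the addresses touched on the way.\<close>

fun runs :: "nat \<Rightarrow> (nat \<Rightarrow> nat \<Rightarrow> nat) \<Rightarrow> program \<Rightarrow> nat set \<Rightarrow> nat set \<Rightarrow> nat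
    \<Rightarrow> state \<Rightarrow> (state \<Rightarrow> bool) \<Rightarrow> bool" where
  "runs w rk P R W 0 st Post \<longleftrightarrow> Post st"
| "runs w rk P R W (Suc t) st Post \<longleftrightarrow> pc st < length P \<and>
     instr_reads (P ! pc st) st \<subseteq> R \<and> instr_writes (P ! pc st) st \<subseteq> W \<and>
     runs w rk P R W t (exec w rk (P ! pc st) st) Post"

lemma runs_numeral:
  "runs w rk P R W (numeral v) st Post \<longleftrightarrow> pc st < length P \<and>
     instr_reads (P ! pc st) st \<subseteq> R \<and> instr_writes (P ! pc st) st \<subseteq> W \<and>
     runs w rk P R W (pred_numeral v) (exec w rk (P ! pc st) st) Post"
  by (simp add: numeral_eq_Suc)

text \<open>Branches and loops of varying length are composed by upper bounds instead of exact step
  counts.\<close>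

definition reaches :: "nat \<Rightarrow> (nat \<Rightarrow> nat \<Rightarrow> nat) \<Rightarrow> program \<Rightarrow> nat set \<Rightarrow> nat set \<Rightarrow> nat
    \<Rightarrow> state \<Rightarrow> (state \<Rightarrow> bool) \<Rightarrow> bool" where
  "reaches w rk P R W t st Post \<longleftrightarrow> (\<exists>t'\<le>t. runs w rk P R W t' st Post)"

text \<open>The length of the second run may depend on the state in between;
  \<open>reaches_trans\<close> obtains it as a choice function.\<close>

lemma runs_add:
  assumes "runs w rk P R W t st Post" "\<And>st'. Post st' \<Longrightarrow> runs w rk P R W (u st') st' Post'"
  shows "\<exists>st'. Post st' \<and> runs w rk P R W (t + u st') st Post'"
  using assms(1) by (induction t arbitrary: st) (use assms(2) in auto)

lemma reachesI: "runs w rk P R W t' st Post \<Longrightarrow> t' \<le> t \<Longrightarrow> reaches w rk P R W t st Post"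
  by (auto simp: reaches_def)

lemma reaches_trans:
  assumes "reaches w rk P R W t st Post" "\<And>st'. Post st' \<Longrightarrow> reaches w rk P R W u st' Post'"
  shows "reaches w rk P R W (t + u) st Post'"
proof -
  obtain t' where t': "t' \<le> t" "runs w rk P R W t' st Post"
    using assms(1) by (auto simp: reaches_def)
  obtain v where v: "\<And>st'. Post st' \<Longrightarrow> v st' \<le> u \<and> runs w rk P R W (v st') st' Post'"
    using assms(2) unfolding reaches_def by metis
  then show ?thesis using runs_add[OF t'(2), of v Post'] t'(1) v
    unfolding reaches_def by (metis add_mono)
qed

lemma reaches_mono: "reaches w rk P R W t st Post \<Longrightarrow> t \<le> t' \<Longrightarrow> reaches w rk P R W t' st Post"
  unfolding reaches_def using le_trans by blast

lemma reaches_loop: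
  assumes "\<And>k st. k < N \<Longrightarrow> Inv k st \<Longrightarrow> reaches w rk P R W t st (Inv (Suc k))" and "Inv 0 st"
  shows "reaches w rk P R W (N * t) st (Inv N)"
  using assms(1)
proof (induction N)
  case 0
  show ?case using assms(2) by (auto intro: reachesI[of _ _ _ _ _ 0])
next
  case (Suc N)
  have "reaches w rk P R W (N * t + t) st (Inv (Suc N))"
    by (rule reaches_trans[OF Suc.IH]) (use Suc.prems in auto)
  then show ?case by (simp add: add.commute)
qed

lemma runs_steps:
  assumes "runs w rk P R W t st Post"
  shows "Post ((step w rk P ^^ t) st)"
    and "i < t \<Longrightarrow> \<not> halted P ((step w rk P ^^ i) st)"
    and "cells_read w rk P st t \<subseteq> R" and "cells_written w rk P st t \<subseteq> W"
proof -
  have *: "Post ((step w rk P ^^ t) st) \<and> (\<forall>i<t. let st' = (step w rk P ^^ i) st in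
    \<not> halted P st' \<and> instr_reads (P ! pc st') st' \<subseteq> R \<and> instr_writes (P ! pc st') st' \<subseteq> W)"
    using assms
  proof (induction t arbitrary: st)
    case (Suc t)
    \<comment> \<open>A run never executes a halted state, so \<open>step\<close> and
      \<open>exec\<close> agree along it.\<close>
    have step: "step w rk P st = exec w rk (P ! pc st) st"
      using Suc.prems by (simp add: step_def halted_def)
    show ?case using Suc.IH[of "step w rk P st"] Suc.prems step
      by (fastforce simp: funpow_Suc_right less_Suc_eq_0_disj Let_def halted_def
        simp del: funpow.simps)
  qed simp
  then show "Post ((step w rk P ^^ t) st)" "i < t \<Longrightarrow> \<not> halted P ((step w rk P ^^ i) st)"
    by (auto simp: Let_def)
  show "cells_read w rk P st t \<subseteq> R" "cells_written w rk P st t \<subseteq> W"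
    using * by (auto simp: cells_read_def cells_written_def Let_def)
qed

lemma reaches_terminates:
  assumes "reaches w rk P R W t st Post" "\<And>st'. Post st' \<Longrightarrow> pc st' = length P"
  obtains t' st' where "t' \<le> t" "terminates w rk P st t' st'" "Post st'"
    "cells_read w rk P st t' \<subseteq> R" "cells_written w rk P st t' \<subseteq> W"
proof -
  obtain t' where "t' \<le> t" "runs w rk P R W t' st Post"
    using assms(1) by (auto simp: reaches_def)
  with runs_steps[OF this(2)] show thesis
    by (intro that[of t' "(step w rk P ^^ t') st"])
      (auto simp: terminates_def halted_def assms(2))
qed

section \<open>Modular arithmetic with wrap-around\<close>

lemma sub_mod_eq: "b \<le> a \<Longrightarrow> a < W \<Longrightarrow> (a + W - b) mod W = a - b" for a b W :: nat
  by (metis Nat.add_diff_assoc2 less_imp_diff_less mod_add_self2 mod_less)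

lemma sub_mod_left_eq: "b \<le> W \<Longrightarrow> (a mod W + W - b) mod W = (a + W - b) mod W" for a b W :: nat
proof -
  assume "b \<le> W"
  then have "a mod W + W - b = a mod W + (W - b)" "a + W - b = a + (W - b)" by auto
  then show ?thesis by (simp only: mod_add_left_eq)
qed

text \<open>A negative difference \<open>a - b\<close> wraps around modulo \<open>W\<close>; adding
  some \<open>c\<close> that is at least \<open>b\<close> undoes this when the true result is below
  \<open>W\<close>. This is how a stored offset is added to a rank.\<close>

lemma add_sub_mod_eq:
  "b \<le> c \<Longrightarrow> b \<le> W \<Longrightarrow> a + c - b < W \<Longrightarrow> (c + (a + W - b) mod W) mod W = a + c - b" for a b c W :: nat
proof -
  assume "b \<le> c" "b \<le> W" "a + c - b < W"
  have "(c + (a + W - b) mod W) mod W = (c + (a + W - b)) mod W" by (simp add: mod_add_right_eq)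
  also have "c + (a + W - b) = (a + c - b) + W" using \<open>b \<le> c\<close> \<open>b \<le> W\<close> by simp
  finally show ?thesis using \<open>a + c - b < W\<close> by simp
qed

section \<open>The two programs\<close>

text \<open>
  Registers: 3 reads the orderings from left to right, 4 holds the constant 1, 5, 6 and 7 are the
  start addresses of the tables of \<open>first_lo\<close>, of \<open>first_hi\<close> and of the row of offsets being
  filled, 8 is the running sum of group sizes, 9 and 10 are the symbols \<open>c\<close> and \<open>d\<close>, 13 is the
  end of the current ordering. The loops start at the instructions 8, 19 and 24.
\<close>

definition preprocess :: program where
  "preprocess =
    [Const 3 0, Const 4 1, Arith Mul 5 0 0, Arith Add 5 5 0, Arith Add 6 5 0, Arith Add 7 6 0,
     Const 8 0, Const 9 0,
     JumpLess 3 0 10, Jump 19,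
     Load 10 3, Arith Add 11 5 10, Store 11 8, Rank 12 10 1, Arith Add 8 8 12,
     Arith Add 11 6 10, Store 11 8, Arith Add 3 3 4, Jump 8,
     JumpLess 9 0 21, Jump 43,
     Arith Add 11 5 9, Load 8 11, Arith Add 13 3 0,
     JumpLess 3 13 26, Jump 40,
     Load 10 3, Arith Add 11 5 10, Load 12 11, Rank 12 9 12, Arith Add 11 6 10, Load 14 11,
     Rank 14 9 14, Arith Sub 15 8 12, Arith Add 11 7 10, Store 11 15, Arith Sub 14 14 12,
     Arith Add 8 8 14, Arith Add 3 3 4, Jump 24,
     Arith Add 9 9 4, Arith Add 7 7 0, Jump 19,
     Move 2 7]"

text \<open>
  Registers: 4 and 5 hold the range, 6 and 13 the constants 1 and 0, 7, 8 and 9 the start addresses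
  of the three tables, 10 the position in the pattern, 12 and 14 the symbols \<open>d\<close> and \<open>c\<close>. The loop
  starts at instruction 19; instruction 2 rejects patterns longer than the rows.
\<close>

definition search :: program where
  "search =
    [Const 4 0, Const 5 0, JumpLess 1 3 34, Move 5 1, JumpLess 4 3 6, Jump 34,
     Const 6 1, Arith Mul 7 0 0, Arith Add 7 7 0, Arith Add 8 7 0, Arith Add 9 8 0, Const 13 0,
     Arith Sub 10 3 6, Arith Add 11 2 10, Load 12 11,
     Arith Add 11 7 12, Load 4 11, Arith Add 11 8 12, Load 5 11,
     JumpLess 13 10 21, Jump 34,
     Arith Sub 10 10 6, Arith Add 11 2 10, Load 14 11,
     Arith Mul 11 0 14, Arith Add 11 9 11, Arith Add 11 11 12, Load 11 11,
     Rank 4 14 4, Arith Add 4 4 11, Rank 5 14 5, Arith Add 5 5 11,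
     Move 12 14, Jump 19]"

lemma length_preprocess: "length preprocess = 44"
  by (simp add: preprocess_def)

lemma length_search: "length search = 34"
  by (simp add: search_def)

text \<open>The tables end at \<open>2 * (\<sigma> * \<sigma>) + 3 * \<sigma>\<close>: the orderings
  take \<open>\<sigma> * \<sigma> + \<sigma>\<close> cells, the two tables of group boundaries
  \<open>2 * \<sigma>\<close>, the offsets \<open>\<sigma> * \<sigma>\<close>. Hence every table
  address is a word.\<close>

locale local_bwt_ram = local_bwt +
  fixes w :: nat and rk :: "nat \<Rightarrow> nat \<Rightarrow> nat"
  assumes rk: "rank_oracle \<sigma> L rk"
    and n_word: "n < 2 ^ w"
    and addr_word: "2 * (\<sigma> * \<sigma>) + 3 * \<sigma> + 1 < 2 ^ w"
begin

text \<open>The address of the first cell after the orderings.\<close>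

definition base :: nat where
  "base = \<sigma> * \<sigma> + \<sigma>"

text \<open>The offset may be negative and is stored modulo the word size.\<close>

definition offset :: "nat \<Rightarrow> nat \<Rightarrow> nat" where
  "offset c d = (pair_lo c d + 2 ^ w - rank c L (first_lo d)) mod 2 ^ w"

definition ordering_table :: "(nat \<Rightarrow> nat) \<Rightarrow> bool" where
  "ordering_table m \<longleftrightarrow> (\<forall>j<\<sigma>. m j = \<pi> [] ! j) \<and> (\<forall>c<\<sigma>. \<forall>j<\<sigma>. m (\<sigma> * Suc c + j) = \<pi> [c] ! j)"

definition first_table :: "(nat \<Rightarrow> nat) \<Rightarrow> bool" where
  "first_table m \<longleftrightarrow> (\<forall>d<\<sigma>. m (base + d) = first_lo d \<and> m (base + \<sigma> + d) = first_hi d)"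

definition offset_table :: "nat \<Rightarrow> (nat \<Rightarrow> nat) \<Rightarrow> bool" where
  "offset_table k m \<longleftrightarrow> (\<forall>c<k. \<forall>d<\<sigma>. m (base + 2 * \<sigma> + \<sigma> * c + d) = offset c d)"

section \<open>Invariants and correctness of the preprocessing\<close>

definition common_inv :: "state \<Rightarrow> bool" where
  "common_inv st \<longleftrightarrow> regs st 0 = \<sigma> \<and> regs st 1 = n \<and> regs st 4 = 1 \<and> regs st 5 = base \<and>
     regs st 6 = base + \<sigma> \<and> ordering_table (mem st)"

text \<open>The tables are indexed by symbols but filled in the order \<open>\<pi> []\<close>, so
  the finished entries are those at \<open>\<pi> [] ! i\<close>.\<close>

definition first_inv :: "nat \<Rightarrow> state \<Rightarrow> bool" where
  "first_inv k st \<longleftrightarrow> common_inv st \<and> pc st = 8 \<and> regs st 3 = k \<and> regs st 7 = base + 2 * \<sigma> \<and>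
     regs st 8 = first_sum k \<and> regs st 9 = 0 \<and>
     (\<forall>i<k. mem st (base + \<pi> [] ! i) = first_sum i \<and> mem st (base + \<sigma> + \<pi> [] ! i) = first_sum (Suc i))"

text \<open>Register 3 runs through the orderings without reset: when round \<open>c\<close> starts
  it points at \<open>\<pi> [c]\<close>.\<close>

definition outer_inv :: "nat \<Rightarrow> state \<Rightarrow> bool" where
  "outer_inv c st \<longleftrightarrow> common_inv st \<and> pc st = 19 \<and> regs st 3 = \<sigma> * Suc c \<and>
     regs st 7 = base + 2 * \<sigma> + \<sigma> * c \<and> regs st 9 = c \<and>
     first_table (mem st) \<and> offset_table c (mem st)"

text \<open>Taking the running sum modulo \<open>2 ^ w\<close> spares a bound on
  \<open>pair_sum\<close>; the one from \<open>pair_range\<close> requires rows of length at least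
  two.\<close>

definition inner_inv :: "nat \<Rightarrow> nat \<Rightarrow> state \<Rightarrow> bool" where
  "inner_inv c k st \<longleftrightarrow> common_inv st \<and> pc st = 24 \<and> regs st 3 = \<sigma> * Suc c + k \<and>
     regs st 7 = base + 2 * \<sigma> + \<sigma> * c \<and> regs st 9 = c \<and> regs st 8 = pair_sum c k mod 2 ^ w \<and>
     regs st 13 = \<sigma> * Suc c + \<sigma> \<and>
     first_table (mem st) \<and> offset_table c (mem st) \<and>
     (\<forall>i<k. mem st (base + 2 * \<sigma> + \<sigma> * c + \<pi> [c] ! i) = offset c (\<pi> [c] ! i))"

lemma base_word: "base + 2 * \<sigma> + \<sigma> * \<sigma> + 1 < 2 ^ w"
  using addr_word by (simp add: base_def)

lemma rk_eq: "c < \<sigma> \<Longrightarrow> i \<le> n \<Longrightarrow> rk c i mod 2 ^ w = rank c L i"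
  using rk rank_le_length[of c L i] n_word by (simp add: rank_oracle_def)

lemma nth_ordering_less: "set y \<subseteq> {..<\<sigma>} \<Longrightarrow> k < \<sigma> \<Longrightarrow> \<pi> y ! k < \<sigma>"
  using nth_mem[of k "\<pi> y"] ordering_set[of y] ordering_length[of y] by auto

lemma nth_ordering_eq_iff:
  "set y \<subseteq> {..<\<sigma>} \<Longrightarrow> i < \<sigma> \<Longrightarrow> j < \<sigma> \<Longrightarrow> \<pi> y ! i = \<pi> y ! j \<longleftrightarrow> i = j"
  using nth_eq_iff_index_eq[OF ordering_distinct[of y], of i j] ordering_length[of y] by simp

lemma ordering_table_upd:
  assumes "ordering_table m" "base \<le> a"
  shows "ordering_table (m(a := v))"
proof -
  have "\<sigma> * Suc c + j < base" if "c < \<sigma>" "j < \<sigma>" for c j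
    using that mult_le_mono2[of "Suc c" \<sigma> \<sigma>] by (simp add: base_def)
  moreover have "j < base" if "j < \<sigma>" for j using that by (simp add: base_def)
  ultimately show ?thesis using assms unfolding ordering_table_def
    by (metis fun_upd_other not_less)
qed

lemma first_table_upd: "first_table m \<Longrightarrow> base + 2 * \<sigma> \<le> a \<Longrightarrow> first_table (m(a := v))"
  by (auto simp: first_table_def)

lemma block_disjoint: "c' < c \<Longrightarrow> d' < \<sigma> \<Longrightarrow> \<sigma> * c' + d' < \<sigma> * c" for c c' d'
  using mult_le_mono2[of "Suc c'" c \<sigma>] by simp

lemma offset_table_upd:
  "offset_table c m \<Longrightarrow> base + 2 * \<sigma> + \<sigma> * c \<le> a \<Longrightarrow> offset_table c (m(a := v))"
  unfolding offset_table_def using block_disjoint by (fastforce simp: add.assoc)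

lemma first_step:
  assumes k: "k < \<sigma>" and inv: "first_inv k st"
  shows "runs w rk preprocess UNIV UNIV 10 st (first_inv (Suc k))"
proof -
  define d where "d = \<pi> [] ! k"
  have d: "d < \<sigma>" using nth_ordering_less[of "[]" k] k by (simp add: d_def)
  obtain r m where st: "st = \<lparr>pc = 8, regs = r, mem = m\<rparr>"
    using inv by (cases st) (simp add: first_inv_def)
  have r: "r 0 = \<sigma>" "r 1 = n" "r 3 = k" "r 4 = 1" "r 5 = base" "r 6 = base + \<sigma>" "r 7 = base + 2 * \<sigma>"
    "r 8 = first_sum k" "r 9 = 0" "r (Suc 0) = n" and table: "ordering_table m"
    and prev: "\<forall>i<k. m (base + \<pi> [] ! i) = first_sum i \<and> m (base + \<sigma> + \<pi> [] ! i) = first_sum (Suc i)"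
    using inv by (auto simp: first_inv_def common_inv_def st)
  have "m k = d" using table k by (simp add: ordering_table_def d_def)
  moreover have "(first_sum k + rank d L n) = first_sum (Suc k)" by (simp add: first_sum_def d_def)
  moreover have "first_sum (Suc k) < 2 ^ w" using first_sum_le[of "Suc k"] k n_word by simp
  moreover have "base + d < 2 ^ w" "base + \<sigma> + d < 2 ^ w" "Suc k < 2 ^ w" using base_word d k by auto
  moreover have "\<forall>i<k. \<pi> [] ! i \<noteq> d" "\<forall>i<k. \<pi> [] ! i < \<sigma>"
    using nth_ordering_eq_iff[of "[]"] nth_ordering_less[of "[]"] k by (auto simp: d_def)
  ultimately show ?thesis
    using k d r table prev rk_eq[OF d, of n]
    by (auto simp: st first_inv_def common_inv_def preprocess_def runs_numeral set_reg_def ordering_table_upd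
       less_Suc_eq d_def[symmetric])
qed

lemma inner_step:
  assumes c: "c < \<sigma>" and k: "k < \<sigma>" and inv: "inner_inv c k st"
  shows "runs w rk preprocess UNIV UNIV 15 st (inner_inv c (Suc k))"
proof -
  define d where "d = \<pi> [c] ! k"
  have d: "d < \<sigma>" using nth_ordering_less[of "[c]" k] c k by (simp add: d_def)
  obtain r m where st: "st = \<lparr>pc = 24, regs = r, mem = m\<rparr>"
    using inv by (cases st) (simp add: inner_inv_def)
  have r: "r 0 = \<sigma>" "r 1 = n" "r 3 = \<sigma> * Suc c + k" "r 4 = 1" "r 5 = base" "r 6 = base + \<sigma>"
    "r 7 = base + 2 * \<sigma> + \<sigma> * c" "r 8 = pair_sum c k mod 2 ^ w" "r 9 = c" "r (Suc 0) = n"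
    "r 13 = \<sigma> * Suc c + \<sigma>"
    and table: "ordering_table m" "first_table m" "offset_table c m"
    and prev: "\<forall>i<k. m (base + 2 * \<sigma> + \<sigma> * c + \<pi> [c] ! i) = offset c (\<pi> [c] ! i)"
    using inv by (auto simp: inner_inv_def common_inv_def st)
  let ?lo = "rank c L (first_lo d)" and ?hi = "rank c L (first_hi d)"
  let ?a = "base + 2 * \<sigma> + \<sigma> * c + d"
  have m: "m (\<sigma> * Suc c + k) = d" "m (base + d) = first_lo d" "m (base + \<sigma> + d) = first_hi d"
    using table k c d by (auto simp: ordering_table_def first_table_def d_def)
  have fb: "first_lo d \<le> first_hi d" "first_lo d \<le> n" "first_hi d \<le> n"
    using first_bounds[of d] d by auto
  have rk': "rk c (first_lo d) mod 2 ^ w = ?lo" "rk c (first_hi d) mod 2 ^ w = ?hi"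
    using rk_eq[OF c] fb by auto
  have ranks: "?lo \<le> ?hi" "?hi < 2 ^ w" "?lo \<le> 2 ^ w"
    using rank_mono[OF fb(1), of L c] rank_le_length[of c L] fb n_word
    by (auto intro: le_less_trans[OF rank_le_length] order.trans[OF rank_le_length])
  \<comment> \<open>Modulo \<open>2 ^ w\<close>, the register holds the sum before the group of
    \<open>d\<close> is added, which is \<open>pair_lo c d\<close>.\<close>
  have off: "(pair_sum c k mod 2 ^ w + 2 ^ w - ?lo) mod 2 ^ w = offset c d"
  proof -
    have "pair_lo c d = pair_sum c k"
      using position_nth[of "\<pi> [c]" k] ordering_distinct[of "[c]"] ordering_length[of "[c]"] c k
      by (simp add: pair_lo_def d_def)
    then show ?thesis using sub_mod_left_eq[OF ranks(3)] by (simp add: offset_def)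
  qed
  have diff: "(?hi + 2 ^ w - ?lo) mod 2 ^ w = pair_count c d"
    using sub_mod_eq[OF ranks(1,2)] by (simp add: pair_count_def)
  have acc: "(pair_sum c k mod 2 ^ w + pair_count c d) mod 2 ^ w = pair_sum c (Suc k) mod 2 ^ w"
    by (simp add: mod_add_left_eq pair_sum_def d_def add.assoc)
  have "\<sigma> * Suc c \<le> \<sigma> * \<sigma>" using c by (intro mult_le_mono2) simp
  then have bounds: "(base + d) mod 2 ^ w = base + d" "(base + \<sigma> + d) mod 2 ^ w = base + \<sigma> + d"
    "?a mod 2 ^ w = ?a" "(\<sigma> * Suc c + k + 1) mod 2 ^ w = \<sigma> * Suc c + Suc k"
    using base_word d k by auto
  have ne: "\<forall>i<k. \<pi> [c] ! i \<noteq> d"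
    using nth_ordering_eq_iff[of "[c]"] k c by (auto simp: d_def)
  \<comment> \<open>The two start addresses are made atoms, so that each address below is an atom
    plus an index and no product is rearranged.\<close>
  define p where "p = \<sigma> * Suc c"
  define T where "T = base + 2 * \<sigma> + \<sigma> * c"
  have p: "\<sigma> + \<sigma> * c = p" by (simp add: p_def)
  have T: "base \<le> T + d" "base + 2 * \<sigma> \<le> T + d" "T \<le> T + d" by (auto simp: T_def)
  show ?thesis
    using r m bounds ne prev k table T
    unfolding p_def[symmetric] T_def[symmetric]
    by (auto simp: st inner_inv_def common_inv_def preprocess_def runs_numeral set_reg_def rk' off diff acc
       ordering_table_upd first_table_upd offset_table_upd[folded T_def] less_Suc_eq d_def[symmetric]
       p T_def[symmetric])
qed

lemma outer_begin:
  assumes c: "c < \<sigma>" and inv: "outer_inv c st"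
  shows "runs w rk preprocess UNIV UNIV 4 st (inner_inv c 0)"
proof -
  obtain r m where st: "st = \<lparr>pc = 19, regs = r, mem = m\<rparr>"
    using inv by (cases st) (simp add: outer_inv_def)
  have "m (base + c) = first_lo c" using inv c by (auto simp: outer_inv_def first_table_def st)
  moreover have "first_lo c mod 2 ^ w = first_lo c" using first_bounds[of c] c n_word by simp
  moreover have "\<sigma> * Suc c \<le> \<sigma> * \<sigma>" using c by (intro mult_le_mono2) simp
  then have "(\<sigma> * Suc c + \<sigma>) mod 2 ^ w = \<sigma> * Suc c + \<sigma>" "(base + c) mod 2 ^ w = base + c"
    using base_word c by auto
  ultimately show ?thesis using inv c
    by (auto simp: st inner_inv_def outer_inv_def common_inv_def preprocess_def runs_numeral set_reg_def
       pair_sum_def)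
qed

text \<open>\<open>\<pi> [c]\<close> lists all symbols, so a row filled in its order is
  complete.\<close>

lemma offset_table_Suc:
  assumes "offset_table c m" "c < \<sigma>"
    "\<forall>i<\<sigma>. m (base + 2 * \<sigma> + \<sigma> * c + \<pi> [c] ! i) = offset c (\<pi> [c] ! i)"
  shows "offset_table (Suc c) m"
proof -
  have "\<exists>i<\<sigma>. d = \<pi> [c] ! i" if "d < \<sigma>" for d
    using that assms(2) ordering_set[of "[c]"] ordering_length[of "[c]"]
    by (metis empty_set empty_subsetI in_set_conv_nth insert_subset lessThan_iff list.simps(15))
  then have "m (base + 2 * \<sigma> + \<sigma> * c + d) = offset c d" if "d < \<sigma>" for d
    using assms(3) that by metis
  then show ?thesis using assms(1) by (auto simp: offset_table_def less_Suc_eq)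
qed

lemma inner_end:
  assumes c: "c < \<sigma>" and inv: "inner_inv c \<sigma> st"
  shows "runs w rk preprocess UNIV UNIV 5 st (outer_inv (Suc c))"
proof -
  obtain r m where st: "st = \<lparr>pc = 24, regs = r, mem = m\<rparr>"
    using inv by (cases st) (simp add: inner_inv_def)
  have "offset_table (Suc c) m"
    using inv c by (intro offset_table_Suc) (auto simp: inner_inv_def st)
  moreover have "\<sigma> * Suc c \<le> \<sigma> * \<sigma>" using c by (intro mult_le_mono2) simp
  then have "(c + 1) mod 2 ^ w = c + 1"
    "(base + 2 * \<sigma> + \<sigma> * c + \<sigma>) mod 2 ^ w = base + 2 * \<sigma> + \<sigma> * c + \<sigma>"
    using base_word c by auto
  ultimately show ?thesis using inv c
    by (auto simp: st inner_inv_def outer_inv_def common_inv_def preprocess_def runs_numeral set_reg_def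
       algebra_simps)
qed

lemma first_end:
  assumes inv: "first_inv \<sigma> st"
  shows "runs w rk preprocess UNIV UNIV 2 st (outer_inv 0)"
proof -
  obtain r m where st: "st = \<lparr>pc = 8, regs = r, mem = m\<rparr>"
    using inv by (cases st) (simp add: first_inv_def)
  have "first_table m"
    unfolding first_table_def
  proof (intro allI impI)
    fix d assume "d < \<sigma>"
    then show "m (base + d) = first_lo d \<and> m (base + \<sigma> + d) = first_hi d"
      using inv position_first[of d] unfolding first_lo_def first_hi_def
      by (auto simp: first_inv_def st) 
  qed
  then show ?thesis using inv
    by (auto simp: st first_inv_def outer_inv_def common_inv_def preprocess_def runs_numeral set_reg_def
       offset_table_def)
qed

definition preprocessed :: "state \<Rightarrow> bool" where
  "preprocessed st \<longleftrightarrow> pc st = 44 \<and> regs st 2 = base + 2 * \<sigma> + \<sigma> * \<sigma> \<and>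
     first_table (mem st) \<and> offset_table \<sigma> (mem st)"

lemma outer_end:
  assumes inv: "outer_inv \<sigma> st"
  shows "runs w rk preprocess UNIV UNIV 3 st preprocessed"
proof -
  obtain r m where st: "st = \<lparr>pc = 19, regs = r, mem = m\<rparr>"
    using inv by (cases st) (simp add: outer_inv_def)
  then show ?thesis using inv
    by (auto simp: outer_inv_def common_inv_def preprocess_def runs_numeral set_reg_def preprocessed_def)
qed

lemma first_begin:
  assumes "preprocessing_input w \<sigma> n \<pi> st"
  shows "runs w rk preprocess UNIV UNIV 8 st (first_inv 0)"
proof -
  obtain r m where st: "st = \<lparr>pc = 0, regs = r, mem = m\<rparr>"
    using assms by (cases st) (simp add: preprocessing_input_def)
  have "(\<sigma> * \<sigma>) mod 2 ^ w = \<sigma> * \<sigma>" "(\<sigma> * \<sigma> + \<sigma>) mod 2 ^ w = base" "(base + \<sigma>) mod 2 ^ w = base + \<sigma>"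
    "(base + \<sigma> + \<sigma>) mod 2 ^ w = base + 2 * \<sigma>" "1 mod 2 ^ w = (1 :: nat)"
    using base_word by (cases w; auto simp: base_def)+
  then show ?thesis using assms
    by (auto simp: st preprocessing_input_def first_inv_def common_inv_def preprocess_def runs_numeral
       set_reg_def ordering_table_def first_sum_def)
qed

text \<open>The bound follows the control flow: 8 steps of setup, \<open>\<sigma>\<close> rounds of
  10 for the first two tables, 2 to leave that loop, \<open>\<sigma>\<close> outer rounds of 4
  steps, \<open>\<sigma>\<close> inner rounds of 15 and 5 closing steps each, and 3 to
  finish.\<close>

lemma preprocess_correct:
  assumes "preprocessing_input w \<sigma> n \<pi> st"
  shows "reaches w rk preprocess UNIV UNIV (8 + (\<sigma> * 10 + (2 + (\<sigma> * (4 + (\<sigma> * 15 + 5)) + 3))))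
    st preprocessed"
proof (intro reaches_trans)
  show "reaches w rk preprocess UNIV UNIV 8 st (first_inv 0)"
    using first_begin[OF assms] by (rule reachesI) simp
  show "reaches w rk preprocess UNIV UNIV (\<sigma> * 10) st' (first_inv \<sigma>)" if "first_inv 0 st'" for st'
    by (rule reaches_loop[where Inv = first_inv]) (use that first_step in \<open>auto intro: reachesI\<close>)
  show "reaches w rk preprocess UNIV UNIV 2 st' (outer_inv 0)" if "first_inv \<sigma> st'" for st'
    using first_end[OF that] by (rule reachesI) simp
  show "reaches w rk preprocess UNIV UNIV 3 st' preprocessed" if "outer_inv \<sigma> st'" for st'
    using outer_end[OF that] by (rule reachesI) simp
  show "reaches w rk preprocess UNIV UNIV (\<sigma> * (4 + (\<sigma> * 15 + 5))) st' (outer_inv \<sigma>)"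
    if "outer_inv 0 st'" for st'
  proof (rule reaches_loop[where Inv = outer_inv], intro reaches_trans)
    fix c st assume c: "c < \<sigma>" and "outer_inv c st"
    then show "reaches w rk preprocess UNIV UNIV 4 st (inner_inv c 0)"
      using outer_begin reachesI by blast
    show "reaches w rk preprocess UNIV UNIV (\<sigma> * 15) st' (inner_inv c \<sigma>)"
      if "inner_inv c 0 st'" for st'
      by (rule reaches_loop[where Inv = "inner_inv c"])
        (use c that inner_step in \<open>auto intro: reachesI\<close>)
    show "reaches w rk preprocess UNIV UNIV 5 st' (outer_inv (Suc c))"
      if "inner_inv c \<sigma> st'" for st'
      using inner_end[OF c that] by (rule reachesI) simp
  qed (use that in auto)
qed

section \<open>Correctness of the backward search\<close>

definition search_inv :: "nat list \<Rightarrow> state \<Rightarrow> nat \<Rightarrow> state \<Rightarrow> bool" where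
  "search_inv x q k st \<longleftrightarrow> (let j = length x - 1 - k in
     pc st = 19 \<and> regs st 0 = \<sigma> \<and> regs st 2 = base + 2 * \<sigma> + \<sigma> * \<sigma> \<and> regs st 6 = 1 \<and>
     regs st 7 = base \<and> regs st 8 = base + \<sigma> \<and> regs st 9 = base + 2 * \<sigma> \<and> regs st 10 = j \<and>
     regs st 12 = x ! j \<and> regs st 13 = 0 \<and> mem st = mem q \<and>
     first_bounded_range (drop j x) (regs st 4) (regs st 5))"

definition search_post :: "nat list \<Rightarrow> state \<Rightarrow> bool" where
  "search_post x st \<longleftrightarrow> pc st = 34 \<and> is_row_range \<pi> s x (regs st 4) (regs st 5)"

context
  fixes m :: "nat \<Rightarrow> nat" and x :: "nat list" and q :: state
  assumes tables: "first_table m" "offset_table \<sigma> m"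
    and x: "set x \<subseteq> {..<\<sigma>}"
    and q: "query_input w \<sigma> n m (base + 2 * \<sigma> + \<sigma> * \<sigma>) x q"
begin

abbreviation (input) "D \<equiv> base + 2 * \<sigma> + \<sigma> * \<sigma>"
abbreviation (input) "reads \<equiv> {..<base + 2 * \<sigma> + \<sigma> * \<sigma> + length x}"

lemma query_first_table: "d < \<sigma> \<Longrightarrow> mem q (base + d) = first_lo d"
    "d < \<sigma> \<Longrightarrow> mem q (base + \<sigma> + d) = first_hi d"
  using q tables(1) by (auto simp: query_input_def first_table_def)

lemma query_offset_table: "c < \<sigma> \<Longrightarrow> d < \<sigma> \<Longrightarrow> mem q (base + 2 * \<sigma> + \<sigma> * c + d) = offset c d"
  using q tables(2) block_disjoint[of c \<sigma> d] by (simp add: query_input_def offset_table_def)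

lemma query_string: "j < length x \<Longrightarrow> mem q (D + j) = x ! j"
  using q by (simp add: query_input_def)

lemma nth_x_less: "j < length x \<Longrightarrow> x ! j < \<sigma>"
  using x nth_mem[of j x] by blast

lemma query_string_word: "D + length x \<le> 2 ^ w" "length x < 2 ^ w"
proof -
  show "D + length x \<le> 2 ^ w" using q by (simp add: query_input_def)
  have "word_state w q" "regs q 3 = length x" using q by (auto simp: query_input_def)
  then show "length x < 2 ^ w" unfolding word_state_def by metis
qed

text \<open>Here \<open>k\<close> counts the backward steps done, while the position in the pattern
  moves left; one round extends the suffix at \<open>Suc i\<close> by the symbol at
  \<open>i\<close>.\<close>

lemma search_step:
  assumes k: "k < length x - 1" and le: "length x \<le> n" and inv: "search_inv x q k st"
  shows "runs w rk search reads {} 14 st (search_inv x q (Suc k))"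
proof -
  define i where "i = length x - 1 - Suc k"
  define c d y where "c = x ! i" and "d = x ! Suc i" and "y = drop (Suc (Suc i)) x"
  have i: "length x - Suc k = Suc i" "Suc i < length x" using k by (auto simp: i_def)
  have drops: "drop (Suc i) x = d # y" "drop i x = c # d # y"
    using i(2) by (simp_all add: c_def d_def y_def Cons_nth_drop_Suc)
  have cd: "c < \<sigma>" "d < \<sigma>" using nth_x_less i by (auto simp: c_def d_def)
  obtain r m' where st: "st = \<lparr>pc = 19, regs = r, mem = m'\<rparr>"
    using inv by (cases st) (simp add: search_inv_def Let_def)
  define b e where "b = r 4" and "e = r 5"
  have r: "r 0 = \<sigma>" "r 2 = D" "r 6 = 1" "r 7 = base" "r 8 = base + \<sigma>" "r 9 = base + 2 * \<sigma>"
    "r 10 = Suc i" "r 12 = d" "r 13 = 0" "r 4 = b" "r 5 = e" "m' = mem q"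
    and range: "first_bounded_range (d # y) b e"
    using inv by (auto simp: search_inv_def Let_def i drops d_def st b_def e_def)
  have be: "first_lo d \<le> b" "b \<le> e" "e \<le> n"
    using range by (auto simp: first_bounded_range_def is_row_range_def)
  have ranks: "rank c L (first_lo d) \<le> rank c L b" "rank c L b \<le> rank c L e"
    "rank c L (first_lo d) \<le> 2 ^ w"
    using be n_word by (auto intro: rank_mono order.trans[OF rank_le_length])
  define b' e' where "b' = pair_lo c d + rank c L b - rank c L (first_lo d)"
    and "e' = pair_lo c d + rank c L e - rank c L (first_lo d)"
  \<comment> \<open>The suffix from \<open>i\<close> on has at most \<open>n\<close> symbols, so the
    one processed so far is strictly shorter than a row.\<close>
  have "length (d # y) < n" using drops(2) le by (metis Suc_le_eq length_Cons length_drop diff_le_self le_trans)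
  then have range': "first_bounded_range (c # d # y) b' e'"
    using backward_step[OF _ cd range] by (simp add: b'_def e'_def)
  then have "b' \<le> n" "e' \<le> n" by (auto simp: first_bounded_range_def is_row_range_def)
  \<comment> \<open>The stored offset may have wrapped around, but the sums are exact because the
    true ends are at most \<open>n\<close>, hence words.\<close>
  then have upd: "(rank c L b + offset c d) mod 2 ^ w = b'" "(rank c L e + offset c d) mod 2 ^ w = e'"
    using add_sub_mod_eq[OF _ ranks(3), of "rank c L b" "pair_lo c d"] ranks n_word
      add_sub_mod_eq[OF _ ranks(3), of "rank c L e" "pair_lo c d"]
    by (auto simp: offset_def b'_def e'_def)
  have rk': "rk c b mod 2 ^ w = rank c L b" "rk c e mod 2 ^ w = rank c L e"
    using rk_eq[OF cd(1)] be by auto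
  have "\<sigma> * c + d < \<sigma> * \<sigma>" using block_disjoint cd by simp
  then have addr: "(\<sigma> * c) mod 2 ^ w = \<sigma> * c" "(base + 2 * \<sigma> + \<sigma> * c) mod 2 ^ w = base + 2 * \<sigma> + \<sigma> * c"
    "(base + 2 * \<sigma> + \<sigma> * c + d) mod 2 ^ w = base + 2 * \<sigma> + \<sigma> * c + d"
    "base + 2 * \<sigma> + \<sigma> * c + d < D + length x"
    "(D + i) mod 2 ^ w = D + i" "D + i < D + length x"
    using base_word query_string_word i by auto
  have sub: "(Suc i + 2 ^ w - 1) mod 2 ^ w = i"
    using sub_mod_eq[of 1 "Suc i" "2 ^ w"] query_string_word i by simp
  have mem: "mem q (D + i) = c" "mem q (base + 2 * \<sigma> + \<sigma> * c + d) = offset c d"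
    using query_string[of i] query_offset_table cd i by (auto simp: c_def)
  define D' O' where "D' = base + 2 * \<sigma> + \<sigma> * \<sigma>" and "O' = base + 2 * \<sigma>"
  show ?thesis
    using r addr sub mem upd rk' range'
    unfolding D'_def[symmetric] O'_def[symmetric]
    by (simp add: st search_inv_def Let_def search_def runs_numeral set_reg_def drops
        i_def[symmetric, simplified] c_def[symmetric] D'_def[symmetric] O'_def[symmetric])
qed

text \<open>These are the two exits before the tables are consulted: a pattern longer than a row
  gets the empty range \<open>[0, 0)\<close>, the empty pattern gets all rows. For empty
  \<open>s\<close> no other pattern is left.\<close>

lemma search_short:
  assumes "length x = 0 \<or> n < length x"
  shows "reaches w rk search reads {} 6 q (search_post x)"
proof -
  obtain r m' where st: "q = \<lparr>pc = 0, regs = r, mem = m'\<rparr>"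
    using q by (cases q) (simp add: query_input_def)
  have r: "r 0 = \<sigma>" "r (Suc 0) = n" "r 3 = length x"
    using q by (auto simp: query_input_def st)
  show ?thesis
  proof (cases "n < length x")
    case True
    then have "\<not> prefix x (M ! i)" if "i < n" for i
      using prefix_length_le[of x "M ! i"] that by auto
    then have "is_row_range \<pi> s x 0 0" by (auto simp: is_row_range_def)
    then have "runs w rk search reads {} 3 q (search_post x)"
      using r True by (simp add: st search_def runs_numeral set_reg_def search_post_def)
    then show ?thesis by (rule reachesI) simp
  next
    case False
    then have [simp]: "x = []" using assms by simp
    have "is_row_range \<pi> s x 0 n" by (auto simp: is_row_range_def)
    then have "runs w rk search reads {} 6 q (search_post x)"
      using r False by (simp add: st search_def runs_numeral set_reg_def search_post_def)
    then show ?thesis by (rule reachesI) simp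
  qed
qed

lemma search_begin:
  assumes "0 < length x" "length x \<le> n"
  shows "runs w rk search reads {} 18 q (search_inv x q 0)"
proof -
  obtain r m' where st: "q = \<lparr>pc = 0, regs = r, mem = m'\<rparr>"
    using q by (cases q) (simp add: query_input_def)
  define i d where "i = length x - 1" and "d = x ! i"
  have i: "length x = Suc i" using assms by (simp add: i_def)
  have r: "r 0 = \<sigma>" "r (Suc 0) = n" "r 2 = D" "r 3 = Suc i"
    using q by (auto simp: query_input_def st i)
  have d: "d < \<sigma>" using nth_x_less i by (simp add: d_def)
  have "drop i x = [d]" using i by (simp add: d_def Cons_nth_drop_Suc[symmetric])
  then have range: "first_bounded_range (drop i x) (first_lo d) (first_hi d)"
    using singleton_range[OF d] by simp
  have addr: "(\<sigma> * \<sigma>) mod 2 ^ w = \<sigma> * \<sigma>" "(\<sigma> * \<sigma> + \<sigma>) mod 2 ^ w = base" "(base + \<sigma>) mod 2 ^ w = base + \<sigma>"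
    "(base + \<sigma> + \<sigma>) mod 2 ^ w = base + 2 * \<sigma>" "Suc 0 mod 2 ^ w = Suc 0"
    using base_word by (cases w; auto simp: base_def)+
  have addr': "(base + d) mod 2 ^ w = base + d" "(base + \<sigma> + d) mod 2 ^ w = base + \<sigma> + d"
    "(D + i) mod 2 ^ w = D + i" "D + i < D + length x" "base + d < D + length x" "base + \<sigma> + d < D + length x"
    using base_word query_string_word i d by auto
  have sub: "(Suc i + 2 ^ w - 1) mod 2 ^ w = i"
    using sub_mod_eq[of 1 "Suc i" "2 ^ w"] query_string_word i by simp
  have mem: "m' (D + i) = d" "m' (base + d) = first_lo d" "m' (base + \<sigma> + d) = first_hi d"
    using query_string[of i] query_first_table[OF d] i by (auto simp: d_def st)
  define D' where "D' = D"
  show ?thesis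
    using r addr addr' sub mem range assms unfolding D'_def[symmetric]
    by (simp add: st search_inv_def Let_def search_def runs_numeral set_reg_def i
        d_def[symmetric] D'_def[symmetric])
qed

lemma search_end:
  assumes "search_inv x q (length x - 1) st" "0 < length x"
  shows "runs w rk search reads {} 2 st (search_post x)"
proof -
  obtain r m' where st: "st = \<lparr>pc = 19, regs = r, mem = m'\<rparr>"
    using assms by (cases st) (simp add: search_inv_def Let_def)
  show ?thesis using assms
    by (simp add: st search_inv_def search_post_def Let_def search_def runs_numeral set_reg_def
        first_bounded_range_def)
qed

lemma search_correct:
  "reaches w rk search reads {} (20 + 14 * length x) q (search_post x)"
proof (cases "length x = 0 \<or> n < length x")
  case True
  from search_short[OF this] show ?thesis by (rule reaches_mono) simp
next
  case False
  have "reaches w rk search reads {} (18 + ((length x - 1) * 14 + 2)) q (search_post x)"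
  proof (intro reaches_trans)
    show "reaches w rk search reads {} 18 q (search_inv x q 0)"
      using search_begin False by (auto intro: reachesI)
    show "reaches w rk search reads {} ((length x - 1) * 14) st' (search_inv x q (length x - 1))"
      if "search_inv x q 0 st'" for st'
      by (rule reaches_loop[where Inv = "search_inv x q"])
        (use that search_step False in \<open>auto intro: reachesI\<close>)
    show "reaches w rk search reads {} 2 st' (search_post x)"
      if "search_inv x q (length x - 1) st'" for st'
      using search_end[OF that] False by (auto intro: reachesI)
  qed
  then show ?thesis by (rule reaches_mono) simp
qed

text \<open>Nothing is written, and from \<open>D\<close> on only the pattern is read, so the space
  bound holds with room to spare.\<close>

lemma computes_range_search:
  "computes_range w rk search \<pi> s x D (50 * max 1 (length x)) (50 * max 1 (length x)) q"
proof -
  obtain t st' where "t \<le> 20 + 14 * length x" "terminates w rk search q t st'" "search_post x st'"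
    "cells_read w rk search q t \<subseteq> reads" "cells_written w rk search q t \<subseteq> {}"
    using reaches_terminates[OF search_correct] by (auto simp: search_post_def length_search)
  moreover have "reads \<subseteq> {..<D + 50 * max 1 (length x)}" by auto
  moreover have "20 + 14 * length x \<le> 50 * max 1 (length x)" by simp
  ultimately show ?thesis unfolding computes_range_def search_post_def
    by (meson empty_subsetI le_trans subset_trans)
qed

end

end

text \<open>Both programs and \<open>C\<close> are fixed before \<open>k\<close>, so only the
  threshold for the word size depends on the exponent in the bound on the alphabet. The
  \<open>max 1\<close> accounts for the constant work that remains for an empty alphabet or
  pattern.\<close>

theorem theorem11:
  shows "\<exists>(P :: program) (Q :: program) (C :: nat). \<forall>k :: nat. \<exists>w\<^sub>0 :: nat.
    \<forall>w \<ge> w\<^sub>0. \<forall>(\<sigma> :: nat) (s :: nat list) (\<pi> :: nat list \<Rightarrow> nat list)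
      (rk :: nat \<Rightarrow> nat \<Rightarrow> nat) (st :: state).
      \<sigma> \<le> w ^ k \<longrightarrow>
      set s \<subseteq> {..<\<sigma>} \<longrightarrow>
      length s < 2 ^ w \<longrightarrow>
      primitive s \<longrightarrow>
      context_orderings {..<\<sigma>} \<pi> \<longrightarrow>
      local_ordering {..<\<sigma>} \<pi> \<longrightarrow>
      rank_oracle \<sigma> (ctx_bwt \<pi> s) rk \<longrightarrow>
      preprocessing_input w \<sigma> (length s) \<pi> st \<longrightarrow>
      (\<exists>t \<le> C * max 1 (\<sigma>\<^sup>2). \<exists>st'.
        terminates w rk P st t st' \<and>
        regs st' 2 \<le> C * max 1 (\<sigma>\<^sup>2) \<and>
        (\<forall>x q. set x \<subseteq> {..<\<sigma>} \<longrightarrow>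
          query_input w \<sigma> (length s) (mem st') (regs st' 2) x q \<longrightarrow>
          computes_range w rk Q \<pi> s x (regs st' 2)
            (C * max 1 (length x)) (C * max 1 (length x)) q))"
proof (rule exI[of _ preprocess], rule exI[of _ search], rule exI[of _ 50], rule allI)
  fix k :: nat
  \<comment> \<open>The numbers 1, \<open>\<sigma>\<close> and \<open>\<sigma> * \<sigma>\<close>
    will all be at most \<open>w ^ (2 * k)\<close>, so the end of the tables plus 1,
    \<open>2 * (\<sigma> * \<sigma>) + 3 * \<sigma> + 1\<close>, is at most 6 times this
    power.\<close>
  obtain w\<^sub>0 :: nat where w0: "\<forall>w\<ge>w\<^sub>0. 6 * w ^ (2 * k) < 2 ^ w"
    using eventually_power_less_two_power by blast
  show "\<exists>w\<^sub>0. \<forall>w\<ge>w\<^sub>0. \<forall>\<sigma> s \<pi> rk st.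
      \<sigma> \<le> w ^ k \<longrightarrow>
      set s \<subseteq> {..<\<sigma>} \<longrightarrow>
      length s < 2 ^ w \<longrightarrow>
      primitive s \<longrightarrow>
      context_orderings {..<\<sigma>} \<pi> \<longrightarrow>
      local_ordering {..<\<sigma>} \<pi> \<longrightarrow>
      rank_oracle \<sigma> (ctx_bwt \<pi> s) rk \<longrightarrow>
      preprocessing_input w \<sigma> (length s) \<pi> st \<longrightarrow>
      (\<exists>t \<le> 50 * max 1 (\<sigma>\<^sup>2). \<exists>st'.
        terminates w rk preprocess st t st' \<and>
        regs st' 2 \<le> 50 * max 1 (\<sigma>\<^sup>2) \<and>
        (\<forall>x q. set x \<subseteq> {..<\<sigma>} \<longrightarrow>
          query_input w \<sigma> (length s) (mem st') (regs st' 2) x q \<longrightarrow>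
          computes_range w rk search \<pi> s x (regs st' 2)
            (50 * max 1 (length x)) (50 * max 1 (length x)) q))"
  \<comment> \<open>The maximum ensures \<open>1 \<le> w\<close> and thereby
    \<open>1 \<le> w ^ (2 * k)\<close>.\<close>
  proof (rule exI[of _ "max 1 w\<^sub>0"], intro allI impI)
    fix w \<sigma> s \<pi> rk st
    assume w: "max 1 w\<^sub>0 \<le> w" and \<sigma>: "\<sigma> \<le> w ^ k" and s: "set s \<subseteq> {..<\<sigma>}"
      and n: "length s < 2 ^ w" and bwt: "primitive s" "context_orderings {..<\<sigma>} \<pi>"
      "local_ordering {..<\<sigma>} \<pi>" "rank_oracle \<sigma> (ctx_bwt \<pi> s) rk"
      and input: "preprocessing_input w \<sigma> (length s) \<pi> st"
    have sq: "\<sigma> \<le> \<sigma> * \<sigma>" "\<sigma>\<^sup>2 = \<sigma> * \<sigma>" by (simp_all add: power2_eq_square)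
    have "\<sigma> * \<sigma> \<le> w ^ k * w ^ k" using \<sigma> by (intro mult_le_mono)
    also have "\<dots> = w ^ (2 * k)" by (simp add: power_add mult_2)
    finally have "\<sigma> * \<sigma> \<le> w ^ (2 * k)" .
    moreover have "1 \<le> w ^ (2 * k)" using w by simp
    moreover have "6 * w ^ (2 * k) < 2 ^ w" using w w0 by simp
    ultimately have addr: "2 * (\<sigma> * \<sigma>) + 3 * \<sigma> + 1 < 2 ^ w" using sq(1) by linarith
    interpret local_bwt_ram \<sigma> s \<pi> w rk
      by unfold_locales (use s n bwt addr in auto)
    obtain t st' where t: "t \<le> 8 + (\<sigma> * 10 + (2 + (\<sigma> * (4 + (\<sigma> * 15 + 5)) + 3)))"
      and st': "terminates w rk preprocess st t st'" "preprocessed st'"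
      using reaches_terminates[OF preprocess_correct[OF input]]
      by (auto simp: preprocessed_def length_preprocess)
    \<comment> \<open>Each of 1, \<open>\<sigma>\<close> and \<open>\<sigma> * \<sigma>\<close> is
      at most \<open>max 1 (\<sigma>\<^sup>2)\<close>, so the factor 13 + 19 + 15 = 47 suffices
      here; 50 also covers the table size with factor 5 and the search with factor 34.\<close>
    have "t \<le> 50 * max 1 (\<sigma>\<^sup>2)"
    proof -
      have "t \<le> 13 + 19 * \<sigma> + 15 * (\<sigma> * \<sigma>)" using t by (simp add: algebra_simps)
      moreover have "1 \<le> max 1 (\<sigma> * \<sigma>)" "\<sigma> * \<sigma> \<le> max 1 (\<sigma> * \<sigma>)" by auto
      ultimately show ?thesis unfolding sq(2) using sq(1) by linarith
    qed
    moreover have "regs st' 2 \<le> 50 * max 1 (\<sigma>\<^sup>2)"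
    proof -
      have "regs st' 2 = 2 * (\<sigma> * \<sigma>) + 3 * \<sigma>"
        using st'(2) by (simp add: preprocessed_def base_def)
      moreover have "\<sigma> * \<sigma> \<le> max 1 (\<sigma> * \<sigma>)" by simp
      ultimately show ?thesis unfolding sq(2) using sq(1) by linarith
    qed
    moreover have "computes_range w rk search \<pi> s x (regs st' 2)
        (50 * max 1 (length x)) (50 * max 1 (length x)) q"
      if "set x \<subseteq> {..<\<sigma>}" "query_input w \<sigma> (length s) (mem st') (regs st' 2) x q" for x q
      using computes_range_search[of "mem st'" x q] st'(2) that by (simp add: preprocessed_def)
    ultimately show "\<exists>t \<le> 50 * max 1 (\<sigma>\<^sup>2). \<exists>st'.
        terminates w rk preprocess st t st' \<and>
        regs st' 2 \<le> 50 * max 1 (\<sigma>\<^sup>2) \<and>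
        (\<forall>x q. set x \<subseteq> {..<\<sigma>} \<longrightarrow>
          query_input w \<sigma> (length s) (mem st') (regs st' 2) x q \<longrightarrow>
          computes_range w rk search \<pi> s x (regs st' 2)
            (50 * max 1 (length x)) (50 * max 1 (length x)) q)"
      using st'(1) by blast
  qed
qed

end
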